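(* The center $Z(\tilde{\mathfrak H})$ of the algebra $\tilde{\mathfrak H}$ consists of the scalars (i.e. equals $\mathbb C\cdot 1$).
   Context: All algebras are associative unital algebras over $\mathbb C$. Parameters: $q,a,b,c,d\in\mathbb C$ with $q\ne0$, $q^m\ne1$ for $m=1,2,\ldots$; $a,b,c,d\ne0$; $abcd\ne q^{-m}$ for $m=0,1,2,\ldots$; and $ab\ne1$. The double affine Hecke algebra $\tilde{\mathfrak H}$ (type $(C_1^\vee,C_1)$) is generated by $T_1,Y,Y^{-1},Z,Z^{-1}$ with relations $YY^{-1}=1=Y^{-1}Y$, $ZZ^{-1}=1=Z^{-1}Z$ and $T_1^2=-(ab+1)T_1-ab$, $T_1Z=Z^{-1}T_1+(ab+1)Z^{-1}-(a+b)$, $T_1Z^{-1}=ZT_1-(ab+1)Z^{-1}+(a+b)$, $T_1Y=q^{-1}abcd\,Y^{-1}T_1-(ab+1)Y+ab(1+q^{-1}cd)$, $T_1Y^{-1}=q(abcd)^{-1}YT_1+q(abcd)^{-1}(1+ab)Y-q(cd)^{-1}(1+q^{-1}cd)$, $YZ=qZY+(1+ab)cd\,Z^{-1}Y^{-1}T_1-(a+b)cd\,Y^{-1}T_1-(1+q^{-1}cd)Z^{-1}T_1-(1-q)(1+ab)(1+q^{-1}cd)Z^{-1}+(c+d)T_1+(1-q)(a+b)(1+q^{-1}cd)$, $YZ^{-1}=q^{-1}Z^{-1}Y-q^{-2}(1+ab)cd\,Z^{-1}Y^{-1}T_1+q^{-2}(a+b)cd\,Y^{-1}T_1+q^{-1}(1+q^{-1}cd)Z^{-1}T_1-q^{-1}(c+d)T_1$,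 $Y^{-1}Z=q^{-1}ZY^{-1}-q(ab)^{-1}(1+ab)Z^{-1}Y^{-1}T_1+(ab)^{-1}(a+b)Y^{-1}T_1+q(abcd)^{-1}(1+q^{-1}cd)Z^{-1}T_1+q(abcd)^{-1}(1-q)(1+ab)(1+q^{-1}cd)Z^{-1}-(abcd)^{-1}(c+d)T_1-(abcd)^{-1}(1-q)(1+ab)(c+d)$, $Y^{-1}Z^{-1}=qZ^{-1}Y^{-1}+q(ab)^{-1}(1+ab)Z^{-1}Y^{-1}T_1-(ab)^{-1}(a+b)Y^{-1}T_1-q^2(abcd)^{-1}(1+q^{-1}cd)Z^{-1}T_1+q(abcd)^{-1}(c+d)T_1$. *)

theory Defs
  imports "HOL-Library.Poly_Mapping" "HOL-Algebra.QuotRing" "HOL-Algebra.Algebraic_Closure_Type" Complex_Main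
begin

datatype daha_gen = Gen_T1 | Gen_Y | Gen_Yinv | Gen_Z | Gen_Zinv

text \<open>Words in the generators form a monoid under concatenation, written additively because
  \<^theory>\<open>HOL-Library.Poly_Mapping\<close> expects an additive index monoid. Thus
  \<open>daha_word \<Rightarrow>\<^sub>0 complex\<close>, with its convolution product, is the free unital associative
  complex algebra on the five generators.\<close>

datatype daha_word = Word (letters: "daha_gen list")

instantiation daha_word :: monoid_add
begin

definition zero_daha_word :: daha_word
  where "0 = Word []"

definition plus_daha_word :: "daha_word \<Rightarrow> daha_word \<Rightarrow> daha_word"
  where "u + v = Word (letters u @ letters v)"

instance
  by standard (simp_all add: zero_daha_word_def plus_daha_word_def)

end

type_synonym daha_free = "daha_word \<Rightarrow>\<^sub>0 complex"

definition gen :: "daha_gen \<Rightarrow> daha_free"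
  where "gen g = Poly_Mapping.single (Word [g]) 1"

definition scalar :: "complex \<Rightarrow> daha_free"
  where "scalar k = Poly_Mapping.single 0 k"

abbreviation scale :: "complex \<Rightarrow> daha_free \<Rightarrow> daha_free"  (infixr "\<cdot>" 75)
  where "k \<cdot> x \<equiv> scalar k * x"

text \<open>A pair \<open>(l, r)\<close> stands for the defining relation \<open>l = r\<close>.\<close>

definition daha_relations ::
    "complex \<Rightarrow> complex \<Rightarrow> complex \<Rightarrow> complex \<Rightarrow> complex \<Rightarrow> (daha_free \<times> daha_free) set"
  where "daha_relations q a b c d =
   (let T = gen Gen_T1; Y = gen Gen_Y; Y' = gen Gen_Yinv; Z = gen Gen_Z; Z' = gen Gen_Zinv
    in {(Y * Y', 1), (Y' * Y, 1), (Z * Z', 1), (Z' * Z, 1),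
      (T * T, - ((a*b + 1) \<cdot> T) - scalar (a*b)),
      (T * Z, Z' * T + (a*b + 1) \<cdot> Z' - scalar (a + b)),
      (T * Z', Z * T - (a*b + 1) \<cdot> Z' + scalar (a + b)),
      (T * Y, (inverse q * (a*b*c*d)) \<cdot> (Y' * T) - (a*b + 1) \<cdot> Y
        + scalar (a*b * (1 + inverse q * (c*d)))),
      (T * Y', (q * inverse (a*b*c*d)) \<cdot> (Y * T) + (q * inverse (a*b*c*d) * (1 + a*b)) \<cdot> Y
        - scalar (q * inverse (c*d) * (1 + inverse q * (c*d)))),
      (Y * Z, q \<cdot> (Z * Y) + ((1 + a*b) * (c*d)) \<cdot> (Z' * Y' * T)
        - ((a + b) * (c*d)) \<cdot> (Y' * T)
        - (1 + inverse q * (c*d)) \<cdot> (Z' * T)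
        - ((1 - q) * (1 + a*b) * (1 + inverse q * (c*d))) \<cdot> Z'
        + (c + d) \<cdot> T
        + scalar ((1 - q) * (a + b) * (1 + inverse q * (c*d)))),
      (Y * Z', inverse q \<cdot> (Z' * Y) - (inverse (q^2) * (1 + a*b) * (c*d)) \<cdot> (Z' * Y' * T)
        + (inverse (q^2) * (a + b) * (c*d)) \<cdot> (Y' * T)
        + (inverse q * (1 + inverse q * (c*d))) \<cdot> (Z' * T)
        - (inverse q * (c + d)) \<cdot> T),
      (Y' * Z, inverse q \<cdot> (Z * Y') - (q * inverse (a*b) * (1 + a*b)) \<cdot> (Z' * Y' * T)
        + (inverse (a*b) * (a + b)) \<cdot> (Y' * T)
        + (q * inverse (a*b*c*d) * (1 + inverse q * (c*d))) \<cdot> (Z' * T)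
        + (q * inverse (a*b*c*d) * (1 - q) * (1 + a*b) * (1 + inverse q * (c*d))) \<cdot> Z'
        - (inverse (a*b*c*d) * (c + d)) \<cdot> T
        - scalar (inverse (a*b*c*d) * (1 - q) * (1 + a*b) * (c + d))),
      (Y' * Z', q \<cdot> (Z' * Y') + (q * inverse (a*b) * (1 + a*b)) \<cdot> (Z' * Y' * T)
        - (inverse (a*b) * (a + b)) \<cdot> (Y' * T)
        - (q^2 * inverse (a*b*c*d) * (1 + inverse q * (c*d))) \<cdot> (Z' * T)
        + (q * inverse (a*b*c*d) * (c + d)) \<cdot> T)})"

abbreviation free_ring :: "daha_free ring"
  where "free_ring \<equiv> ring_of_type_algebra"

text \<open>Ideals in HOL-Algebra are two-sided; a two-sided ideal of the free algebra contains
  the complex multiples of its elements, so the ring quotient is the algebra quotient.\<close>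

definition daha_ideal :: "complex \<Rightarrow> complex \<Rightarrow> complex \<Rightarrow> complex \<Rightarrow> complex \<Rightarrow> daha_free set"
  where "daha_ideal q a b c d = Idl\<^bsub>free_ring\<^esub> {l - r | l r. (l, r) \<in> daha_relations q a b c d}"

definition daha :: "complex \<Rightarrow> complex \<Rightarrow> complex \<Rightarrow> complex \<Rightarrow> complex \<Rightarrow> daha_free set ring"
  where "daha q a b c d = free_ring Quot daha_ideal q a b c d"

definition daha_class ::
    "complex \<Rightarrow> complex \<Rightarrow> complex \<Rightarrow> complex \<Rightarrow> complex \<Rightarrow> daha_free \<Rightarrow> daha_free set"
  where "daha_class q a b c d x = daha_ideal q a b c d +>\<^bsub>free_ring\<^esub> x"

definition ring_center :: "('a, 'm) ring_scheme \<Rightarrow> 'a set"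
  where "ring_center R = {x \<in> carrier R. \<forall>y \<in> carrier R. x \<otimes>\<^bsub>R\<^esub> y = y \<otimes>\<^bsub>R\<^esub> x}"

lemma ring_free_ring: "ring free_ring"
proof -
  have "\<exists>y. x + y = 0 \<and> y + x = 0" for x :: daha_free
    by (rule exI[of _ "- x"]) simp
  then show ?thesis
    unfolding ring_of_type_algebra_def
    by unfold_locales (auto simp: algebra_simps Units_def)
qed

lemma ideal_daha_ideal: "ideal (daha_ideal q a b c d) free_ring"
  unfolding daha_ideal_def
  by (rule ring.genideal_ideal[OF ring_free_ring]) (simp add: ring_of_type_algebra_def)

lemma ring_daha: "ring (daha q a b c d)"
  unfolding daha_def by (rule ideal.quotient_is_ring[OF ideal_daha_ideal])

lemma daha_class_hom: "daha_class q a b c d \<in> ring_hom free_ring (daha q a b c d)"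
  unfolding daha_def daha_class_def[abs_def] by (rule ideal.rcos_ring_hom[OF ideal_daha_ideal])

lemma carrier_daha: "carrier (daha q a b c d) = range (daha_class q a b c d)"
  unfolding daha_def daha_class_def FactRing_def A_RCOSETS_def'
  by (auto simp: ring_of_type_algebra_def)

lemma daha_relations_hold:
  assumes "(l, r) \<in> daha_relations q a b c d"
  shows "daha_class q a b c d l = daha_class q a b c d r"
proof -
  interpret R: ring free_ring by (rule ring_free_ring)
  interpret I: ideal "daha_ideal q a b c d" free_ring by (rule ideal_daha_ideal)
  have "l - r \<in> daha_ideal q a b c d"
    using assms R.genideal_self[of "{l - r | l r. (l, r) \<in> daha_relations q a b c d}"]
    by (auto simp: daha_ideal_def ring_of_type_algebra_def)
  moreover have "l = (l - r) \<oplus>\<^bsub>free_ring\<^esub> r" by (simp add: ring_of_type_algebra_def)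
  ultimately have "l \<in> daha_ideal q a b c d +>\<^bsub>free_ring\<^esub> r"
    unfolding a_r_coset_def' by blast
  then show ?thesis
    unfolding daha_class_def
    by (rule R.a_repr_independence[OF _ _ I.a_subgroup, symmetric])
      (simp_all add: ring_of_type_algebra_def)
qed

end

theory Submission
  imports Defs "HOL-Analysis.Continuum_Not_Denumerable" "HOL-Computational_Algebra.Polynomial"
begin

text \<open>
  The algebra acts by the Demazure--Lusztig operators \<open>T\<^sub>1 = \<alpha> + \<beta> s\<close> and
  \<open>T\<^sub>0 = \<gamma> + \<delta> s\<^sub>0\<close>, with \<open>Y = T\<^sub>1 T\<^sub>0\<close>, on the functions on one orbit of a generic point
  \<open>x\<close> under the infinite dihedral group generated by \<open>s : z \<mapsto> 1/z\<close> and \<open>s\<^sub>0 : z \<mapsto> q/z\<close>; for generic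
  \<open>x\<close> this action on the orbit is free and no denominator or coefficient \<open>\<beta>\<close>, \<open>\<delta>\<close> vanishes there.
  The relations show that the monomials \<open>Z\<^sup>m Y\<^sup>n T\<^sub>1\<^sup>i\<close> span. Each \<open>Y\<^sup>n T\<^sub>1\<^sup>i\<close> has a leading term at a
  different element of the dihedral group, so these monomials act linearly independently and the
  representation is faithful. A central element commutes with \<open>Z\<close>, which separates
  the points of the orbit, so it acts by multiplication with a function; commuting with \<open>T\<^sub>1\<close>
  and \<open>T\<^sub>0 = T\<^sub>1\<^sup>-\<^sup>1 Y\<close> makes this function constant on the orbit.
\<close>

section \<open>Operators on a generic orbit\<close>

text \<open>The orbit is indexed by the integers such that \<open>s\<close> is \<open>k \<mapsto> - 1 - k\<close> and \<open>s\<^sub>0\<close> is \<open>k \<mapsto> 1 - k\<close>;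
  then \<open>s s\<^sub>0\<close> and its inverse are the shifts by \<open>2\<close>. Below, \<open>opT\<close> and \<open>opU\<close> stand for \<open>T\<^sub>1\<close> and \<open>T\<^sub>0\<close>.\<close>

locale generic_orbit =
  fixes q a b c d :: complex and z :: "int \<Rightarrow> complex"
  assumes q_nz: "q \<noteq> 0" and a_nz: "a \<noteq> 0" and b_nz: "b \<noteq> 0" and c_nz: "c \<noteq> 0" and d_nz: "d \<noteq> 0"
    and z_nz: "z k \<noteq> 0"
    and z_s1: "z (- 1 - k) = 1 / z k"
    and z_s0: "z (1 - k) = q / z k"
    and z_sq1: "z k ^ 2 \<noteq> 1" and z_sqq: "z k ^ 2 \<noteq> q"
    and z_a: "a * z k \<noteq> 1" and z_b: "b * z k \<noteq> 1" and z_c: "z k \<noteq> c" and z_d: "z k \<noteq> d"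
    and z_inj: "inj z"
begin

lemmas nz = q_nz a_nz b_nz c_nz d_nz z_nz

text \<open>The quadratic relation of T_0 has the roots \<open>-1\<close> and
  \<open>- c * d / q\<close>, and \<open>h\<close> is minus their sum; it plays the part that
  \<open>a * b + 1\<close> plays for T_1.\<close>

definition h where "h = 1 + c * d / q"
text \<open>The numerators are balanced so that constant functions are eigenvectors:
  \<open>alpha k + beta k = - a * b\<close> and
  \<open>gamma k + delta k = - c * d / q\<close>.\<close>

definition alpha where "alpha k = ((a + b) * z k - (1 + a * b)) / (1 - z k ^ 2)"
definition beta where "beta k = (1 - a * z k) * (1 - b * z k) / (1 - z k ^ 2)"
definition gamma where "gamma k = z k * (h * z k - (c + d)) / (q - z k ^ 2)"
definition delta where "delta k = - ((c - z k) * (d - z k)) / (q - z k ^ 2)"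

definition opT where "opT f k = alpha k * f k + beta k * f (- 1 - k)"
definition opU where "opU f k = gamma k * f k + delta k * f (1 - k)"
text \<open>The two inverses are solved from the quadratic relations of T_1 and T_0.\<close>

definition opTi where "opTi f k = - (opT f k + (a * b + 1) * f k) / (a * b)"
definition opUi where "opUi f k = - (opU f k + h * f k) * q / (c * d)"
definition opZ where "opZ f k = z k * f k"
definition opZi where "opZi f k = f k / z k"

text \<open>On the pair of points \<open>k\<close>, \<open>- 1 - k\<close> the operator is a 2x2
  matrix, and the claim is Cayley-Hamilton for it: fact \<open>1\<close> says that the trace is
  \<open>- (a * b + 1)\<close>, and fact \<open>2\<close> then amounts to the determinant being
  \<open>a * b\<close>.\<close>

lemma opT_opT: "opT (opT f) k = - (a * b + 1) * opT f k - a * b * f k"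
proof -
  define D where "D = 1 - z k ^ 2"
  have z: "z k \<noteq> 0" "1 - z k ^ 2 \<noteq> 0" "z k ^ 2 - 1 \<noteq> 0" using z_nz z_sq1[of k] by auto
  have D: "D \<noteq> 0" using z D_def by simp
  define A where "A = (a + b) * z k - (1 + a * b)"
  \<comment> \<open>\<open>A'\<close> and \<open>B'\<close> are the numerators at the reflected
    point, where z becomes 1/z, brought over the same denominator \<open>D\<close>.\<close>
  define A' where "A' = z k * ((1 + a * b) * z k - (a + b))"
  define B where "B = (1 - a * z k) * (1 - b * z k)"
  define B' where "B' = - ((z k - a) * (z k - b))"
  have coeff: "alpha k = A / D" "beta k = B / D"
    by (simp_all add: alpha_def beta_def A_def B_def D_def)
  have coeff': "alpha (- 1 - k) = A' / D" "beta (- 1 - k) = B' / D"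
    using z by (simp_all add: alpha_def beta_def A'_def B'_def D_def z_s1 divide_simps)
      (simp_all add: algebra_simps power2_eq_square)
  have "A + A' = - (a * b + 1) * D"
    by (simp add: A_def A'_def D_def algebra_simps power2_eq_square)
  then have 1: "alpha k + alpha (- 1 - k) = - (a * b + 1)"
    using D unfolding coeff coeff' by (simp add: add_divide_distrib[symmetric])
  have "A * A + B * B' = (- (a * b + 1) * A - a * b * D) * D"
    by (simp add: A_def B_def B'_def D_def algebra_simps power2_eq_square)
  then have "(A * A + B * B') / (D * D) = (- (a * b + 1) * A - a * b * D) / D"
    using D by simp
  then have 2: "alpha k * alpha k + beta k * beta (- 1 - k) = - (a * b + 1) * alpha k - a * b"
    using D unfolding coeff coeff' by (simp add: add_divide_distrib diff_divide_distrib)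
  have "opT (opT f) k = (alpha k * alpha k + beta k * beta (- 1 - k)) * f k
      + beta k * (alpha k + alpha (- 1 - k)) * f (- 1 - k)"
    by (simp add: opT_def algebra_simps)
  then show ?thesis unfolding 1 2 by (simp add: opT_def algebra_simps)
qed

lemma opU_opU: "opU (opU f) k = - h * opU f k - c * d / q * f k"
proof -
  define D where "D = q - z k ^ 2"
  have z: "z k \<noteq> 0" "q - z k ^ 2 \<noteq> 0" "z k ^ 2 - q \<noteq> 0" "q \<noteq> 0"
    using z_nz q_nz z_sqq[of k] by (auto simp: power2_eq_square)
  have D: "D \<noteq> 0" using z D_def by simp
  define A where "A = z k * (h * z k - (c + d))"
  define A' where "A' = - (h * q - (c + d) * z k)"
  define B where "B = - ((c - z k) * (d - z k))"
  define B' where "B' = (c * z k - q) * (d * z k - q) / q"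
  have coeff: "gamma k = A / D" "delta k = B / D"
    by (simp_all add: gamma_def delta_def A_def B_def D_def)
  have den: "q - (q / z k) ^ 2 = - (q * D / z k ^ 2)"
    using z by (simp add: D_def field_simps power2_eq_square)
  have num: "h * (q / z k) - (c + d) = (h * q - (c + d) * z k) / z k"
    "c - q / z k = (c * z k - q) / z k" "d - q / z k = (d * z k - q) / z k"
    using z(1) by (simp_all add: diff_divide_distrib)
  have frac: "q / z k * (x / z k) / - (q * D / z k ^ 2) = - x / D"
    "- (x / z k * (y / z k)) / - (q * D / z k ^ 2) = x * y / q / D" for x y
    using z(1,4) D by (simp_all add: field_simps power2_eq_square)
  have coeff': "gamma (1 - k) = A' / D" "delta (1 - k) = B' / D"
    unfolding gamma_def delta_def A'_def B'_def z_s0 den num by (rule frac)+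
  have "A + A' = - h * D"
    by (simp add: A_def A'_def D_def algebra_simps power2_eq_square)
  then have 1: "gamma k + gamma (1 - k) = - h"
    using D unfolding coeff coeff' by (simp add: add_divide_distrib[symmetric])
  \<comment> \<open>In terms of \<open>e\<close> the division by \<open>q\<close> disappears, and
    the identity is one between polynomials.\<close>
  define e where "e = c * d / q"
  have h: "h = 1 + e" by (simp add: h_def e_def)
  have B: "B = - (q * e - (c + d) * z k + z k ^ 2)" and B': "B' = e * z k ^ 2 - (c + d) * z k + q"
    using z(4) by (simp_all add: B_def B'_def e_def field_simps power2_eq_square)
  have "A * A + B * B' = (- h * A - c * d / q * D) * D"
    unfolding B B' A_def D_def e_def[symmetric] h by (simp add: algebra_simps power2_eq_square)
  then have "(A * A + B * B') / (D * D) = (- h * A - c * d / q * D) / D"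
    using D by simp
  then have 2: "gamma k * gamma k + delta k * delta (1 - k) = - h * gamma k - c * d / q"
    using D unfolding coeff coeff' by (simp add: add_divide_distrib diff_divide_distrib)
  have "opU (opU f) k = (gamma k * gamma k + delta k * delta (1 - k)) * f k
      + delta k * (gamma k + gamma (1 - k)) * f (1 - k)"
    by (simp add: opU_def algebra_simps)
  then show ?thesis unfolding 1 2 by (simp add: opU_def algebra_simps)
qed

lemma op_linear:
  "opT (\<lambda>i. u * f i + v * g i) k = u * opT f k + v * opT g k"
  "opU (\<lambda>i. u * f i + v * g i) k = u * opU f k + v * opU g k"
  "opTi (\<lambda>i. u * f i + v * g i) k = u * opTi f k + v * opTi g k"
  "opUi (\<lambda>i. u * f i + v * g i) k = u * opUi f k + v * opUi g k"
  "opZ (\<lambda>i. u * f i + v * g i) k = u * opZ f k + v * opZ g k"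
  "opZi (\<lambda>i. u * f i + v * g i) k = u * opZi f k + v * opZi g k"
  using nz by (simp_all add: opT_def opU_def opTi_def opUi_def opZ_def opZi_def field_simps)

lemma op_linear3:
  "opT (\<lambda>i. u * f i + v * g i + w * e i) k = u * opT f k + v * opT g k + w * opT e k"
  "opUi (\<lambda>i. u * f i + v * g i + w * e i) k = u * opUi f k + v * opUi g k + w * opUi e k"
  using nz by (simp_all add: opT_def opU_def opUi_def field_simps)

lemma opT_opTi: "opT (opTi f) = f" and opTi_opT: "opTi (opT f) = f"
proof -
  show "opTi (opT f) = f"
    using nz by (auto simp: opTi_def opT_opT field_simps)
  have "opT (opTi f) k = f k" for k
  proof -
    have "opTi f = (\<lambda>i. (- 1 / (a * b)) * opT f i + (- (a * b + 1) / (a * b)) * f i)"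
      using nz by (auto simp: opTi_def field_simps)
    then show ?thesis using nz by (simp only: op_linear opT_opT) (simp add: field_simps)
  qed
  then show "opT (opTi f) = f" by auto
qed

lemma opU_opUi: "opU (opUi f) = f" and opUi_opU: "opUi (opU f) = f"
proof -
  show "opUi (opU f) = f"
    using nz by (auto simp: opUi_def opU_opU field_simps)
  have "opU (opUi f) k = f k" for k
  proof -
    have "opUi f = (\<lambda>i. (- q / (c * d)) * opU f i + (- h * q / (c * d)) * f i)"
      using nz by (auto simp: opUi_def field_simps)
    then show ?thesis using nz by (simp only: op_linear opU_opU) (simp add: field_simps)
  qed
  then show "opU (opUi f) = f" by auto
qed

section \<open>Cross relations between the reflection operators and multiplication by z\<close>

lemma opT_eq: "opT f = (\<lambda>k. (- (a * b)) * opTi f k + (- (a * b + 1)) * f k)"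
  using nz by (auto simp: opTi_def field_simps)

lemma opU_eq: "opU f = (\<lambda>k. (- (c * d) / q) * opUi f k + (- h) * f k)"
  using nz by (auto simp: opUi_def field_simps)

text \<open>The reflection turns z into 1/z, so moving Z through the reflected part gives Z^-1 and
  only \<open>alpha k * (z k - 1 / z k)\<close> remains, in which the denominator of
  \<open>alpha\<close> cancels.\<close>

lemma opT_opZ: "opT (opZ f) k = opZi (opT f) k + (a * b + 1) * opZi f k - (a + b) * f k"
proof -
  have z: "z k \<noteq> 0" "1 - z k ^ 2 \<noteq> 0" using z_nz z_sq1[of k] by auto
  have e: "z k - 1 / z k = - ((1 - z k ^ 2) / z k)" using z by (simp add: field_simps power2_eq_square)
  have 1: "alpha k * (z k - 1 / z k) = (a * b + 1) / z k - (a + b)"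
    unfolding e using z by (simp add: alpha_def) (simp add: field_simps)?
  have "opT (opZ f) k = alpha k * (z k - 1 / z k) * f k + (alpha k * f k + beta k * f (- 1 - k)) / z k"
    using z(1) by (simp add: opT_def opZ_def z_s1 algebra_simps diff_divide_distrib add_divide_distrib)
  then show ?thesis unfolding 1 by (simp add: opT_def opZi_def algebra_simps)
qed

lemma opT_opZi: "opT (opZi f) k = opZ (opT f) k - (a * b + 1) * opZi f k + (a + b) * f k"
proof -
  have z: "z k \<noteq> 0" "1 - z k ^ 2 \<noteq> 0" using z_nz z_sq1[of k] by auto
  have e: "1 / z k - z k = (1 - z k ^ 2) / z k" using z by (simp add: field_simps power2_eq_square)
  have 1: "alpha k * (1 / z k - z k) = - (a * b + 1) / z k + (a + b)"
    unfolding e using z by (simp add: alpha_def) (simp add: field_simps)?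
  have "opT (opZi f) k = alpha k * (1 / z k - z k) * f k + (alpha k * f k + beta k * f (- 1 - k)) * z k"
    using z(1) by (simp add: opT_def opZi_def z_s1 algebra_simps diff_divide_distrib add_divide_distrib)
  then show ?thesis unfolding 1 by (simp add: opT_def opZi_def opZ_def algebra_simps add_divide_distrib diff_divide_distrib)
qed

text \<open>This analogue for T_0 is not a defining relation. As Y = T_1 T_0, the four relations
  that exchange Y and Y^-1 with Z and Z^-1 come from these cross relations and their counterparts
  for the inverses.\<close>

lemma opU_opZ: "opU (opZ f) k = q * opZi (opU f) k + (- h) * opZ f k + (c + d) * f k"
proof -
  have z: "z k \<noteq> 0" "q - z k ^ 2 \<noteq> 0" using z_nz z_sqq[of k] by auto
  have e: "z k - q / z k = - ((q - z k ^ 2) / z k)" using z by (simp add: field_simps power2_eq_square)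
  have 1: "gamma k * (z k - q / z k) = - h * z k + (c + d)"
    unfolding e using z by (simp add: gamma_def) (simp add: field_simps)?
  have "opU (opZ f) k = gamma k * (z k - q / z k) * f k + q * (gamma k * f k + delta k * f (1 - k)) / z k"
    using z(1) by (simp add: opU_def opZ_def z_s0 algebra_simps diff_divide_distrib add_divide_distrib)
  then show ?thesis unfolding 1 by (simp add: opU_def opZ_def opZi_def algebra_simps)
qed

lemma opU_opZi: "opU (opZi f) k = (1 / q) * opZ (opU f) k + (h / q) * opZ f k + (- (c + d) / q) * f k"
proof -
  have z: "z k \<noteq> 0" "q - z k ^ 2 \<noteq> 0" "q \<noteq> 0" using z_nz q_nz z_sqq[of k] by auto
  have e: "1 / z k - z k / q = (q - z k ^ 2) / (z k * q)" using z by (simp add: field_simps power2_eq_square)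
  have 1: "gamma k * (1 / z k - z k / q) = (h / q) * z k - (c + d) / q"
    unfolding e using z by (simp add: gamma_def) (simp add: field_simps)?
  have "opU (opZi f) k = gamma k * (1 / z k - z k / q) * f k + (gamma k * f k + delta k * f (1 - k)) * z k / q"
    using z(1) by (simp add: opU_def opZi_def z_s0 algebra_simps diff_divide_distrib add_divide_distrib)
  then show ?thesis unfolding 1 using z by (simp add: opU_def opZ_def opZi_def field_simps)
qed

text \<open>An equality of functions with all three coefficients written out, even the
  \<open>1\<close>, so that \<open>op_linear3\<close> can push \<open>opUi\<close> through the right
  side.\<close>

lemma opTi_opZ: "opTi (opZ f) =
    (\<lambda>k. 1 * opZi (opTi f) k + ((a + b) / (a * b)) * f k + (- (a * b + 1) / (a * b)) * opZ f k)"
  unfolding opTi_def[of "opZ f"] opT_opZ using nz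
  by (intro ext) (simp add: opT_eq[of f] opZi_def field_simps)

lemma opTi_opZi: "opTi (opZi f) =
    (\<lambda>k. 1 * opZ (opTi f) k + (- (a + b) / (a * b)) * f k + ((a * b + 1) / (a * b)) * opZ f k)"
  unfolding opTi_def[of "opZi f"] opT_opZi using nz
  by (intro ext) (simp add: opT_eq[of f] opZi_def opZ_def field_simps)

lemma opUi_opZ: "opUi (opZ f) k =
    q * opZi (opUi f) k + (q ^ 2 * h / (c * d)) * opZi f k - (q * (c + d) / (c * d)) * f k"
  unfolding opUi_def[of "opZ f"] opU_opZ using nz
  by (simp add: opU_eq[of f] opZi_def opZ_def field_simps power2_eq_square)

lemma opUi_opZi: "opUi (opZi f) k =
    (1 / q) * opZ (opUi f) k + ((c + d) / (c * d)) * f k - (h * q / (c * d)) * opZi f k"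
  unfolding opUi_def[of "opZi f"] opU_opZi using nz
  by (simp add: opU_eq[of f] opZi_def opZ_def field_simps power2_eq_square)

section \<open>The defining relations that involve Y\<close>

abbreviation opY where "opY f \<equiv> opT (opU f)"
abbreviation opYi where "opYi f \<equiv> opUi (opTi f)"

text \<open>Since Y^-1 T_1 = T_0^-1, this is the quadratic relation of T_1 applied to
  \<open>opU f\<close>, with the remaining \<open>opU f\<close> expressed through
  \<open>opUi f\<close>.\<close>

lemma rel_TY: "opT (opY f) k = (inverse q * (a*b*c*d)) * opYi (opT f) k - (a*b + 1) * opY f k
        + (a*b * (1 + inverse q * (c*d))) * f k"
proof -
  have "inverse q * (a * b * c * d) * opUi f k = - (a * b) * (opU f k + h * f k)"
    using nz(1-5) by (simp add: opUi_def field_simps)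
  moreover have "1 + inverse q * (c * d) = h" by (simp add: h_def divide_inverse mult.commute)
  ultimately show ?thesis unfolding opTi_opT opT_opT by (simp only:) (simp add: algebra_simps)
qed

lemma rel_TYi: "opT (opYi f) k = (q * inverse (a*b*c*d)) * opY (opT f) k + (q * inverse (a*b*c*d) * (1 + a*b)) * opY f k
        - (q * inverse (c*d) * (1 + inverse q * (c*d))) * f k"
proof -
  have 1: "opYi f = (\<lambda>i. (- q / (c * d)) * opU (opTi f) i + (- h * q / (c * d)) * opTi f i)"
    using nz by (auto simp: opUi_def field_simps)
  have 2: "opTi f = (\<lambda>i. (- 1 / (a * b)) * opT f i + (- (a * b + 1) / (a * b)) * f i)"
      using nz by (auto simp: opTi_def field_simps)
  have 3: "opU (opTi f) = (\<lambda>i. (- 1 / (a * b)) * opU (opT f) i + (- (a * b + 1) / (a * b)) * opU f i)"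
    unfolding 2 by (intro ext op_linear)
  show ?thesis unfolding 1 op_linear opT_opTi 3 using nz by (simp add: h_def field_simps)
qed

text \<open>Z is moved first past T_0 and then past T_1. What remains are multiples of
  \<open>f k\<close>, \<open>opT f k\<close> and \<open>opU f k\<close>, and the last becomes
  \<open>opUi f k\<close>, which is Y^-1 T_1 in the relation.\<close>

lemma rel_YZ: "opY (opZ f) k = q * opZ (opY f) k + ((1 + a*b) * (c*d)) * opZi (opYi (opT f)) k
        - ((a + b) * (c*d)) * opYi (opT f) k
        - (1 + inverse q * (c*d)) * opZi (opT f) k
        - ((1 - q) * (1 + a*b) * (1 + inverse q * (c*d))) * opZi f k
        + (c + d) * opT f k
        + ((1 - q) * (a + b) * (1 + inverse q * (c*d))) * f k"
proof -
  \<comment> \<open>Treating cd/q and 1/z as atoms makes the final comparison polynomial.\<close>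
  define e W where "e = c * d / q" and "W = inverse (z k)"
  have r: "c * d = q * e" using nz by (simp add: e_def)
  have h: "1 + inverse q * (c * d) = h" by (simp add: h_def divide_inverse mult.commute)
  have U: "opU f k = - e * opUi f k - h * f k" by (simp add: opU_eq[of f] e_def)
  have 1: "opU (opZ f) = (\<lambda>k. q * opZi (opU f) k + (- h) * opZ f k + (c + d) * f k)"
    by (auto simp: opU_opZ)
  show ?thesis unfolding 1 op_linear3 opT_opZi opT_opZ opTi_opT h
    unfolding opZi_def opZ_def divide_inverse W_def[symmetric] U r
    by (simp add: algebra_simps)
qed

lemma rel_YZi: "opY (opZi f) k = inverse q * opZi (opY f) k - (inverse (q^2) * (1 + a*b) * (c*d)) * opZi (opYi (opT f)) k
        + (inverse (q^2) * (a + b) * (c*d)) * opYi (opT f) k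
        + (inverse q * (1 + inverse q * (c*d))) * opZi (opT f) k
        - (inverse q * (c + d)) * opT f k"
proof -
  define e W where "e = c * d / q" and "W = inverse (z k)"
  have r: "c * d = q * e" using nz by (simp add: e_def)
  have h: "1 + inverse q * (c * d) = h" by (simp add: h_def divide_inverse mult.commute)
  have U: "opU f k = - e * opUi f k - h * f k" by (simp add: opU_eq[of f] e_def)
  have 1: "opU (opZi f) = (\<lambda>k. (1 / q) * opZ (opU f) k + (h / q) * opZ f k + (- (c + d) / q) * f k)"
    by (auto simp: opU_opZi)
  have 2: "inverse (q ^ 2) * u * (q * e) = inverse q * e * u" for u
    using nz by (simp add: field_simps power2_eq_square)
  show ?thesis unfolding 1 op_linear3 opT_opZi opT_opZ opTi_opT h
    unfolding opZi_def opZ_def divide_inverse W_def[symmetric] U r 2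
    by (simp add: algebra_simps)
qed

lemma rel_YiZ: "opYi (opZ f) k = inverse q * opZ (opYi f) k - (q * inverse (a*b) * (1 + a*b)) * opZi (opYi (opT f)) k
        + (inverse (a*b) * (a + b)) * opYi (opT f) k
        + (q * inverse (a*b*c*d) * (1 + inverse q * (c*d))) * opZi (opT f) k
        + (q * inverse (a*b*c*d) * (1 - q) * (1 + a*b) * (1 + inverse q * (c*d))) * opZi f k
        - (inverse (a*b*c*d) * (c + d)) * opT f k
        - (inverse (a*b*c*d) * (1 - q) * (1 + a*b) * (c + d)) * f k"
proof -
  \<comment> \<open>These atoms hide all divisions except that by \<open>q\<close>; the only
    dependence between them and the parameters that is needed is
    \<open>(1 + a * b) * P = 1 + P\<close>.\<close>
  define P A B W where "P = inverse (a * b)" and "A = q * h / (c * d)" and "B = (c + d) / (c * d)"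
    and "W = inverse (z k)"
  have h: "1 + inverse q * (c * d) = h" by (simp add: h_def divide_inverse mult.commute)
  have T: "P * opT f k = - opTi f k - (1 + P) * f k"
    using nz by (simp add: opTi_def P_def field_simps)
  have coeff: "(1 + a * b) * P = 1 + P" "(a * b + 1) / (a * b) = 1 + P" "(a + b) / (a * b) = (a + b) * P"
    "inverse (a * b) = P" "q ^ 2 * h / (c * d) = q * A" "q * (c + d) / (c * d) = q * B"
    "(c + d) / (c * d) = B" "h * q / (c * d) = A"
    using nz by (simp_all add: P_def A_def B_def field_simps power2_eq_square)
  have "inverse (a * b * c * d) = P * inverse (c * d)" by (simp add: P_def mult.assoc)
  then have cA: "q * inverse (a * b * c * d) * h = P * A" and cB: "inverse (a * b * c * d) * (c + d) = P * B"
    by (simp_all only: A_def B_def divide_inverse mult_ac)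
  have "opYi (opZ f) k = inverse q * opZ (opYi f) k + B * opTi f k - A * W * opTi f k + (a + b) * P * opUi f k
      - (1 + P) * (q * W * opUi f k + q * A * W * f k - q * B * f k)"
    unfolding opTi_opZ op_linear3 opUi_opZi opUi_opZ minus_divide_left[symmetric] coeff
    unfolding opZi_def opZ_def divide_inverse W_def[symmetric]
    by (simp add: algebra_simps)
  also have "\<dots> = inverse q * opZ (opYi f) k - q * ((1 + a * b) * P) * W * opUi f k
        + P * (a + b) * opUi f k
        + A * W * (P * opT f k)
        + A * (1 - q) * ((1 + a * b) * P) * W * f k
        - B * (P * opT f k)
        - B * (1 - q) * ((1 + a * b) * P) * f k"
    unfolding coeff T by (simp add: algebra_simps)
  also have "\<dots> = inverse q * opZ (opYi f) k - q * P * (1 + a * b) * (W * opUi f k)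
        + P * (a + b) * opUi f k
        + P * A * (W * opT f k)
        + P * A * ((1 - q) * (1 + a * b)) * (W * f k)
        - P * B * opT f k
        - P * B * ((1 - q) * (1 + a * b)) * f k"
    by (simp add: mult_ac)
  finally show ?thesis unfolding h opTi_opT coeff cA[symmetric] cB[symmetric]
    by (simp add: opZi_def divide_inverse W_def mult_ac)
qed

lemma rel_YiZi: "opYi (opZi f) k = q * opZi (opYi f) k + (q * inverse (a*b) * (1 + a*b)) * opZi (opYi (opT f)) k
        - (inverse (a*b) * (a + b)) * opYi (opT f) k
        - (q^2 * inverse (a*b*c*d) * (1 + inverse q * (c*d))) * opZi (opT f) k
        + (q * inverse (a*b*c*d) * (c + d)) * opT f k"
proof -
  define P A B W where "P = inverse (a * b)" and "A = q * h / (c * d)" and "B = (c + d) / (c * d)"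
    and "W = inverse (z k)"
  have h: "1 + inverse q * (c * d) = h" by (simp add: h_def divide_inverse mult.commute)
  have T: "P * opT f k = - opTi f k - (1 + P) * f k"
    using nz by (simp add: opTi_def P_def field_simps)
  have coeff: "(1 + a * b) * P = 1 + P" "(a * b + 1) / (a * b) = 1 + P" "(a + b) / (a * b) = (a + b) * P"
    "inverse (a * b) = P" "q ^ 2 * h / (c * d) = q * A" "q * (c + d) / (c * d) = q * B"
    "(c + d) / (c * d) = B" "h * q / (c * d) = A"
    using nz by (simp_all add: P_def A_def B_def field_simps power2_eq_square)
  have "inverse (a * b * c * d) = P * inverse (c * d)" by (simp add: P_def mult.assoc)
  then have cA: "q * inverse (a * b * c * d) * h = P * A" and cB: "inverse (a * b * c * d) * (c + d) = P * B"
    by (simp_all only: A_def B_def divide_inverse mult_ac)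
  have "opYi (opZi f) k = q * opZi (opYi f) k + q * A * W * opTi f k - q * B * opTi f k - (a + b) * P * opUi f k
      + (1 + P) * (q * W * opUi f k + q * A * W * f k - q * B * f k)"
    unfolding opTi_opZi op_linear3 opUi_opZi opUi_opZ minus_divide_left[symmetric] coeff
    unfolding opZi_def opZ_def divide_inverse W_def[symmetric]
    by (simp add: algebra_simps)
  also have "\<dots> = q * opZi (opYi f) k + q * ((1 + a * b) * P) * W * opUi f k
        - P * (a + b) * opUi f k
        - q * A * W * (P * opT f k)
        + q * B * (P * opT f k)"
    unfolding coeff T by (simp add: algebra_simps)
  also have "\<dots> = q * opZi (opYi f) k + q * P * (1 + a * b) * (W * opUi f k)
        - P * (a + b) * opUi f k
        - q * (P * A) * (W * opT f k)
        + q * (P * B) * opT f k"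
    by (simp add: mult_ac)
  finally show ?thesis unfolding h opTi_opT coeff cA[symmetric] cB[symmetric]
    by (simp add: opZi_def divide_inverse W_def mult_ac power2_eq_square)
qed

end

section \<open>Spanning monomials\<close>

lemma free_induct [case_names zero single add]:
  fixes x :: daha_free
  assumes "P 0" and "\<And>w k. P (Poly_Mapping.single w k)" and "\<And>x y. P x \<Longrightarrow> P y \<Longrightarrow> P (x + y)"
  shows "P x"
proof (induction x rule: update_induct)
  case const
  then show ?case by (rule assms(1))
next
  case (update f w k)
  have "Poly_Mapping.update w k f = f + Poly_Mapping.single w k"
    using update(1)
    by (intro poly_mapping_eqI) (auto simp: lookup_update lookup_add lookup_single in_keys_iff when_def)
  then show ?case using update(3) assms(2,3) by metis
qed

lemma scalar_commute: "x * scalar k = scalar k * x"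
  by (induction x rule: free_induct)
    (simp_all add: scalar_def mult_single mult.commute distrib_left distrib_right)

lemma scalar_mult: "scalar (k * l) = scalar k * scalar l"
  by (simp add: scalar_def mult_single)

lemma scalar_add: "scalar (k + l) = scalar k + scalar l"
  by (simp add: scalar_def single_add)

lemma scalar_0 [simp]: "scalar 0 = 0" and scalar_1 [simp]: "scalar 1 = 1"
  by (simp_all add: scalar_def)

lemma scalar_uminus: "scalar (- k) = - scalar k"
  by (simp add: scalar_def single_uminus)

lemma single_word: "Poly_Mapping.single (Word gs) k = scalar k * prod_list (map gen gs)"
proof (induction gs)
  case Nil
  then show ?case by (simp add: scalar_def zero_daha_word_def)
next
  case (Cons g gs)
  have "Poly_Mapping.single (Word (g # gs)) k = gen g * Poly_Mapping.single (Word gs) k"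
    by (simp add: gen_def mult_single plus_daha_word_def)
  then show ?case unfolding Cons
    by (simp add: mult.assoc[symmetric] scalar_commute)
qed

abbreviation gT where "gT \<equiv> gen Gen_T1"
abbreviation gY where "gY \<equiv> gen Gen_Y"
abbreviation gY' where "gY' \<equiv> gen Gen_Yinv"
abbreviation gZ where "gZ \<equiv> gen Gen_Z"
abbreviation gZ' where "gZ' \<equiv> gen Gen_Zinv"

definition Zpow :: "int \<Rightarrow> daha_free"
  where "Zpow m = (if 0 \<le> m then gZ ^ nat m else gZ' ^ nat (- m))"

definition Ypow :: "int \<Rightarrow> daha_free"
  where "Ypow n = (if 0 \<le> n then gY ^ nat n else gY' ^ nat (- n))"

text \<open>\<open>bas (2 * n)\<close> is \<open>Y\<^sup>n\<close> and \<open>bas (2 * n + 1)\<close> is \<open>Y\<^sup>n T\<^sub>1\<close>; with this indexing \<open>\<bar>j\<bar>\<close> is the length of the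
  dihedral group element at which \<open>bas j\<close> has its leading term.\<close>

definition bas :: "int \<Rightarrow> daha_free"
  where "bas j = Ypow (j div 2) * (if even j then 1 else gT)"

section \<open>Linear spans modulo the defining ideal\<close>

locale daha_congruence =
  fixes q a b c d :: complex
begin

abbreviation J where "J \<equiv> daha_ideal q a b c d"

lemma J_ideal: "0 \<in> J" "x \<in> J \<Longrightarrow> y \<in> J \<Longrightarrow> x + y \<in> J" "x \<in> J \<Longrightarrow> r * x \<in> J" "x \<in> J \<Longrightarrow> x * r \<in> J"
proof -
  interpret I: ideal J free_ring by (rule ideal_daha_ideal)
  show "0 \<in> J" "x \<in> J \<Longrightarrow> y \<in> J \<Longrightarrow> x + y \<in> J" "x \<in> J \<Longrightarrow> r * x \<in> J" "x \<in> J \<Longrightarrow> x * r \<in> J"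
    using additive_subgroup.zero_closed[OF I.is_additive_subgroup]
      additive_subgroup.a_closed[OF I.is_additive_subgroup, of x y] I.I_l_closed[of x r] I.I_r_closed[of x r]
    by (auto simp: ring_of_type_algebra_def)
qed

text \<open>In this form the insertion rules can search the list of relations for the entry with a
  given left side, which also determines the right side.\<close>

lemmas relI = daha_relations_def[unfolded Let_def, THEN equalityD2, THEN subsetD]

lemma J_rel: "(l, r) \<in> daha_relations q a b c d \<Longrightarrow> l - r \<in> J"
proof -
  interpret R: ring free_ring by (rule ring_free_ring)
  show "(l, r) \<in> daha_relations q a b c d \<Longrightarrow> l - r \<in> J"
    using R.genideal_self[of "{l - r | l r. (l, r) \<in> daha_relations q a b c d}"]
    by (auto simp: daha_ideal_def ring_of_type_algebra_def)
qed

text \<open>The linear span of \<open>G\<close> modulo the ideal; admitting all of \<open>J\<close>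
  lets the reductions be carried out in the free algebra without passing to cosets.\<close>

inductive_set lspan :: "daha_free set \<Rightarrow> daha_free set" for G
  where
    lspan_J: "x \<in> J \<Longrightarrow> x \<in> lspan G"
  | lspan_base: "x \<in> G \<Longrightarrow> x \<in> lspan G"
  | lspan_add: "x \<in> lspan G \<Longrightarrow> y \<in> lspan G \<Longrightarrow> x + y \<in> lspan G"
  | lspan_scale: "x \<in> lspan G \<Longrightarrow> scalar k * x \<in> lspan G"

lemma lspan_minus: "x \<in> lspan G \<Longrightarrow> - x \<in> lspan G"
  using lspan_scale[of x G "- 1"] by (simp add: scalar_uminus)

lemma lspan_diff: "x \<in> lspan G \<Longrightarrow> y \<in> lspan G \<Longrightarrow> x - y \<in> lspan G"
  using lspan_add[of x G "- y"] lspan_minus by simp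

lemma lspan_mult:
  assumes "\<And>g. g \<in> G \<Longrightarrow> y * g \<in> lspan H" and "x \<in> lspan G"
  shows "y * x \<in> lspan H"
  using assms(2)
proof induction
  case (lspan_scale x k)
  have "y * (scalar k * x) = scalar k * (y * x)"
    by (simp add: mult.assoc[symmetric] scalar_commute)
  then show ?case using lspan_scale by (simp add: lspan.lspan_scale)
qed (auto simp: distrib_left intro: assms(1) J_ideal lspan.intros)

lemma lspan_mono: "G \<subseteq> lspan H \<Longrightarrow> lspan G \<subseteq> lspan H"
  using lspan_mult[of G 1 H] by auto

lemma lspan_cong: "x - y \<in> J \<Longrightarrow> y \<in> lspan G \<Longrightarrow> x \<in> lspan G"
  using lspan_add[OF lspan_J, of "x - y" y G] by simp

text \<open>The ideal is stable under right multiplication, so a relation may be applied at the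
  front of a product.\<close>

lemma rel_lspan:
  assumes "(l, r) \<in> daha_relations q a b c d" and "r * u \<in> lspan G"
  shows "l * u \<in> lspan G"
  using lspan_cong[of "l * u" "r * u"] J_ideal(4)[OF J_rel[OF assms(1)], of u] assms(2)
  by (simp add: left_diff_distrib)

lemmas lspan_intros = lspan_add lspan_diff lspan_minus lspan_scale

text \<open>A filtration by the degree in Z alone, with \<open>j\<close> unrestricted: it is
  preserved by T_1, Y and Y^-1, and multiplication by Z or Z^-1 raises it by one step.\<close>

definition Mon :: "nat \<Rightarrow> daha_free set"
  where "Mon M = {Zpow m * bas j | m j. \<bar>m\<bar> \<le> int M}"

lemma inverse_rels:
  "gY * (gY' * u) - u \<in> J" "gY' * (gY * u) - u \<in> J"
  "gZ * (gZ' * u) - u \<in> J" "gZ' * (gZ * u) - u \<in> J"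
proof -
  have *: "g * (g' * u) - u \<in> J" if "(g * g', 1) \<in> daha_relations q a b c d" for g g'
    using J_ideal(4)[OF J_rel[OF that], of u] by (simp add: left_diff_distrib mult.assoc)
  show "gY * (gY' * u) - u \<in> J" "gY' * (gY * u) - u \<in> J"
    "gZ * (gZ' * u) - u \<in> J" "gZ' * (gZ * u) - u \<in> J"
    by (rule *, rule relI, (rule insertI1 | rule insertI2)+)+
qed

text \<open>The two sides are literally equal when the exponent moves away from zero; otherwise a
  factor cancels by an inverse relation, hence the congruence.\<close>

lemma Ypow_shift: "gY * Ypow n - Ypow (n + 1) \<in> J" "gY' * Ypow n - Ypow (n - 1) \<in> J"
proof -
  have 1: "gY * Ypow n = Ypow (n + 1)" if "n \<ge> 0" for n
    using that by (simp add: Ypow_def nat_add_distrib)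
  have 2: "gY' * Ypow n = Ypow (n - 1)" if "n \<le> 0" for n
  proof -
    have "nat (1 - n) = Suc (nat (- n))" using that by simp
    then show ?thesis using that by (auto simp: Ypow_def)
  qed
  show "gY * Ypow n - Ypow (n + 1) \<in> J"
    using 1[of n] 2[of "n + 1"] inverse_rels(1)[of "Ypow (n + 1)"] J_ideal(1) by (cases "n \<ge> 0") auto
  show "gY' * Ypow n - Ypow (n - 1) \<in> J"
    using 2[of n] 1[of "n - 1"] inverse_rels(2)[of "Ypow (n - 1)"] J_ideal(1) by (cases "n \<le> 0") auto
qed

lemma Zpow_shift: "gZ * Zpow n - Zpow (n + 1) \<in> J" "gZ' * Zpow n - Zpow (n - 1) \<in> J"
proof -
  have 1: "gZ * Zpow n = Zpow (n + 1)" if "n \<ge> 0" for n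
    using that by (simp add: Zpow_def nat_add_distrib)
  have 2: "gZ' * Zpow n = Zpow (n - 1)" if "n \<le> 0" for n
  proof -
    have "nat (1 - n) = Suc (nat (- n))" using that by simp
    then show ?thesis using that by (auto simp: Zpow_def)
  qed
  show "gZ * Zpow n - Zpow (n + 1) \<in> J"
    using 1[of n] 2[of "n + 1"] inverse_rels(3)[of "Zpow (n + 1)"] J_ideal(1) by (cases "n \<ge> 0") auto
  show "gZ' * Zpow n - Zpow (n - 1) \<in> J"
    using 2[of n] 1[of "n - 1"] inverse_rels(4)[of "Zpow (n - 1)"] J_ideal(1) by (cases "n \<le> 0") auto
qed

lemma cong_mult_right: "x - y \<in> J \<Longrightarrow> y * u \<in> lspan G \<Longrightarrow> x * u \<in> lspan G"
  using lspan_cong[of "x * u" "y * u"] J_ideal(4)[of "x - y" u] by (simp add: left_diff_distrib)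

section \<open>Stability of the filtration under the generators\<close>

lemma Mon_mono: "M \<le> N \<Longrightarrow> lspan (Mon M) \<subseteq> lspan (Mon N)"
  by (rule lspan_mono) (auto simp: Mon_def intro!: lspan_base)

lemma Z_Mon:
  assumes "x \<in> lspan (Mon M)"
  shows "gZ * x \<in> lspan (Mon (Suc M))" "gZ' * x \<in> lspan (Mon (Suc M))"
proof -
  have "gZ * g \<in> lspan (Mon (Suc M))" "gZ' * g \<in> lspan (Mon (Suc M))" if "g \<in> Mon M" for g
  proof -
    from that obtain m j where g: "g = Zpow m * bas j" and m: "\<bar>m\<bar> \<le> int M" by (auto simp: Mon_def)
    have "Zpow (m + 1) * bas j \<in> lspan (Mon (Suc M))" "Zpow (m - 1) * bas j \<in> lspan (Mon (Suc M))"
      using m unfolding Mon_def by (intro lspan_base; force)+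
    then show "gZ * g \<in> lspan (Mon (Suc M))" "gZ' * g \<in> lspan (Mon (Suc M))"
      unfolding g mult.assoc[symmetric] by (auto intro: cong_mult_right Zpow_shift)
  qed
  then show "gZ * x \<in> lspan (Mon (Suc M))" "gZ' * x \<in> lspan (Mon (Suc M))"
    using lspan_mult assms by blast+
qed

lemma bas_Mon: "Ypow n \<in> lspan (Mon M)" "Ypow n * gT \<in> lspan (Mon M)"
proof -
  have "Zpow 0 * bas (2 * n) \<in> Mon M" "Zpow 0 * bas (2 * n + 1) \<in> Mon M"
    unfolding Mon_def by fastforce+
  then show "Ypow n \<in> lspan (Mon M)" "Ypow n * gT \<in> lspan (Mon M)"
    by (auto simp: bas_def Zpow_def intro: lspan_base)
qed

lemma Mon_0_cases:
  assumes "g \<in> Mon 0"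
  obtains n u where "g = Ypow n * u" "u = 1 \<or> u = gT"
  using assms by (auto simp: Mon_def Zpow_def bas_def)

lemma Y_Mon_0:
  assumes "x \<in> lspan (Mon 0)"
  shows "gY * x \<in> lspan (Mon 0)" "gY' * x \<in> lspan (Mon 0)"
proof -
  have "gY * g \<in> lspan (Mon 0)" "gY' * g \<in> lspan (Mon 0)" if "g \<in> Mon 0" for g
  proof -
    from that obtain n u where g: "g = Ypow n * u" "u = 1 \<or> u = gT" by (rule Mon_0_cases)
    have "Ypow n * u \<in> lspan (Mon 0)" for n
      using g(2) bas_Mon by auto
    then show "gY * g \<in> lspan (Mon 0)" "gY' * g \<in> lspan (Mon 0)"
      unfolding g mult.assoc[symmetric] by (auto intro: cong_mult_right Ypow_shift)
  qed
  then show "gY * x \<in> lspan (Mon 0)" "gY' * x \<in> lspan (Mon 0)"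
    using lspan_mult assms by blast+
qed

text \<open>The right sides of the two relations yield only u, Y u and Y or Y^-1 times T_1 u, which
  the hypotheses cover.\<close>

lemma T_step_Y:
  assumes "u \<in> lspan (Mon 0)" "gT * u \<in> lspan (Mon 0)"
  shows "gT * (gY * u) \<in> lspan (Mon 0)" "gT * (gY' * u) \<in> lspan (Mon 0)"
proof -
  note u = assms Y_Mon_0[OF assms(1)] Y_Mon_0[OF assms(2)]
  have "gT * gY * u \<in> lspan (Mon 0)"
    by (rule rel_lspan, rule relI, (rule insertI1 | rule insertI2)+)
      (simp add: distrib_right left_diff_distrib mult.assoc, intro lspan_intros u)
  then show "gT * (gY * u) \<in> lspan (Mon 0)" by (simp add: mult.assoc)
  have "gT * gY' * u \<in> lspan (Mon 0)"
    by (rule rel_lspan, rule relI, (rule insertI1 | rule insertI2)+)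
      (simp add: distrib_right left_diff_distrib mult.assoc, intro lspan_intros u)
  then show "gT * (gY' * u) \<in> lspan (Mon 0)" by (simp add: mult.assoc)
qed

lemma T_Mon_0:
  assumes "x \<in> lspan (Mon 0)"
  shows "gT * x \<in> lspan (Mon 0)"
proof (rule lspan_mult[OF _ assms])
  fix g assume "g \<in> Mon 0"
  then obtain n u where g: "g = Ypow n * u" and u: "u = 1 \<or> u = gT" by (rule Mon_0_cases)
  have Yu: "Ypow n * u \<in> lspan (Mon 0)" for n
    using u bas_Mon by auto
  have gT: "gT \<in> lspan (Mon 0)" and one: "1 \<in> lspan (Mon 0)"
    using bas_Mon[of 0] by (auto simp: Ypow_def)
  \<comment> \<open>The trailing \<open>1\<close> supplies the right factor that
    \<open>rel_lspan\<close> expects.\<close>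
  have "gT * gT * 1 \<in> lspan (Mon 0)"
    by (rule rel_lspan, rule relI, (rule insertI1 | rule insertI2)+)
      (simp, intro lspan_intros lspan_scale[OF one, simplified] gT)
  then have 0: "gT * u \<in> lspan (Mon 0)"
    using u gT by auto
  have 1: "gT * (gY ^ n * u) \<in> lspan (Mon 0)" "gT * (gY' ^ n * u) \<in> lspan (Mon 0)" for n
  proof (induction n)
    case (Suc n)
    have "gY ^ n * u \<in> lspan (Mon 0)" "gY' ^ n * u \<in> lspan (Mon 0)"
      using Yu[of "int n"] Yu[of "- int n"] by (auto simp: Ypow_def split: if_splits)
    then show "gT * (gY ^ Suc n * u) \<in> lspan (Mon 0)" "gT * (gY' ^ Suc n * u) \<in> lspan (Mon 0)"
      using T_step_Y Suc by (simp_all add: mult.assoc)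
  qed (use 0 in auto)
  then show "gT * g \<in> lspan (Mon 0)"
    unfolding g Ypow_def by auto
qed

text \<open>Induction on the degree in Z. Moving T_1, Y or Y^-1 past one letter Z or Z^-1 leaves at
  most one such letter, in front of a word in T_1, Y, Y^-1 that the induction hypothesis handles.
  The relations mix the three generators, so the claims are proved together.\<close>

lemma TY_Mon:
  "x \<in> lspan (Mon M) \<Longrightarrow> gT * x \<in> lspan (Mon M) \<and> gY * x \<in> lspan (Mon M) \<and> gY' * x \<in> lspan (Mon M)"
proof (induction M arbitrary: x)
  case 0
  then show ?case using T_Mon_0 Y_Mon_0 by blast
next
  case (Suc M)
  let ?S = "lspan (Mon (Suc M))"
  have gen: "gT * g \<in> ?S \<and> gY * g \<in> ?S \<and> gY' * g \<in> ?S" if g: "g \<in> Mon (Suc M)" for g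
  proof -
    from g obtain m j where m: "g = Zpow m * bas j" "\<bar>m\<bar> \<le> int (Suc M)" by (auto simp: Mon_def)
    consider "\<bar>m\<bar> \<le> int M" | "m = int (Suc M)" | "m = - int (Suc M)" using m(2) by linarith
    then show ?thesis
    proof cases
      case 1
      then have "g \<in> lspan (Mon M)" using m by (auto simp: Mon_def intro!: lspan_base)
      then show ?thesis using Suc.IH[of g] Mon_mono[of M "Suc M"] by auto
    next
      case 2
      define u where "u = Zpow (int M) * bas j"
      have u0: "u \<in> lspan (Mon M)" by (auto simp: u_def Mon_def intro!: lspan_base)
      have g: "g = gZ * u" unfolding m u_def 2 by (simp add: Zpow_def mult.assoc nat_add_distrib)
      note T = Suc.IH[OF u0, THEN conjunct1] and V = Suc.IH[OF u0, THEN conjunct2, THEN conjunct2]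
        and Y = Suc.IH[OF u0, THEN conjunct2, THEN conjunct1]
      note VT = Suc.IH[OF T, THEN conjunct2, THEN conjunct2]
      \<comment> \<open>The elements u, T_1 u, Y^-1 u, Y u and Y^-1 T_1 u are all that the right
        sides need, alone or behind Z or Z^-1.\<close>
      note fact0 = u0 T V Y VT
      note facts = fact0[THEN subsetD[OF Mon_mono[of M "Suc M"], rotated]] fact0[THEN Z_Mon(1)] fact0[THEN Z_Mon(2)]
      have "gT * gZ * u \<in> ?S"
        by (rule rel_lspan, rule relI, (rule insertI1 | rule insertI2)+)
          (simp add: distrib_right left_diff_distrib mult.assoc, intro lspan_intros facts le_SucI le_refl)
      moreover have "gY * gZ * u \<in> ?S"
        by (rule rel_lspan, rule relI, (rule insertI1 | rule insertI2)+)
          (simp add: distrib_right left_diff_distrib mult.assoc, intro lspan_intros facts le_SucI le_refl)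
      moreover have "gY' * gZ * u \<in> ?S"
        by (rule rel_lspan, rule relI, (rule insertI1 | rule insertI2)+)
          (simp add: distrib_right left_diff_distrib mult.assoc, intro lspan_intros facts le_SucI le_refl)
      ultimately show ?thesis by (simp add: g mult.assoc)
    next
      case 3
      define u where "u = Zpow (- int M) * bas j"
      have u0: "u \<in> lspan (Mon M)" by (auto simp: u_def Mon_def intro!: lspan_base)
      have g: "g = gZ' * u" unfolding m u_def 3 by (simp add: Zpow_def mult.assoc nat_add_distrib)
      note T = Suc.IH[OF u0, THEN conjunct1] and V = Suc.IH[OF u0, THEN conjunct2, THEN conjunct2]
        and Y = Suc.IH[OF u0, THEN conjunct2, THEN conjunct1]
      note VT = Suc.IH[OF T, THEN conjunct2, THEN conjunct2]
      note fact0 = u0 T V Y VT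
      note facts = fact0[THEN subsetD[OF Mon_mono[of M "Suc M"], rotated]] fact0[THEN Z_Mon(1)] fact0[THEN Z_Mon(2)]
      have "gT * gZ' * u \<in> ?S"
        by (rule rel_lspan, rule relI, (rule insertI1 | rule insertI2)+)
          (simp add: distrib_right left_diff_distrib mult.assoc, intro lspan_intros facts le_SucI le_refl)
      moreover have "gY * gZ' * u \<in> ?S"
        by (rule rel_lspan, rule relI, (rule insertI1 | rule insertI2)+)
          (simp add: distrib_right left_diff_distrib mult.assoc, intro lspan_intros facts le_SucI le_refl)
      moreover have "gY' * gZ' * u \<in> ?S"
        by (rule rel_lspan, rule relI, (rule insertI1 | rule insertI2)+)
          (simp add: distrib_right left_diff_distrib mult.assoc, intro lspan_intros facts le_SucI le_refl)
      ultimately show ?thesis by (simp add: g mult.assoc)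
    qed
  qed
  show ?case using lspan_mult[OF _ Suc.prems] gen by blast
qed

text \<open>The span contains \<open>1\<close> and is stable under left multiplication by every
  generator, so it contains all words.\<close>

lemma all_lspan: "x \<in> lspan (\<Union>M. Mon M)"
proof -
  let ?S = "lspan (\<Union>M. Mon M)"
  have sub: "lspan (Mon M) \<subseteq> ?S" for M
    by (rule lspan_mono) (auto intro: lspan_base)
  have step: "gen g * x \<in> ?S" if "x \<in> ?S" for g x
  proof (rule lspan_mult[OF _ that])
    fix y assume "y \<in> (\<Union>M. Mon M)"
    then obtain M where y: "y \<in> lspan (Mon M)" by (auto intro: lspan_base)
    show "gen g * y \<in> ?S"
      using TY_Mon[OF y] Z_Mon[OF y] sub[of M] sub[of "Suc M"] by (cases g) auto
  qed
  have one: "1 \<in> ?S" using bas_Mon(1)[of 0 0] sub[of 0] by (auto simp: Ypow_def)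
  have "prod_list (map gen gs) \<in> ?S" for gs
    by (induction gs) (auto intro: one step)
  then have "Poly_Mapping.single w k \<in> ?S" for w k
    by (cases w) (auto simp: single_word intro: lspan_scale)
  then show ?thesis
    by (induction x rule: free_induct) (auto intro: lspan_add lspan_J J_ideal)
qed

end

section \<open>The representation and its faithfulness\<close>

context generic_orbit
begin

fun genop :: "daha_gen \<Rightarrow> (int \<Rightarrow> complex) \<Rightarrow> int \<Rightarrow> complex"
  where
    "genop Gen_T1 f = opT f"
  | "genop Gen_Y f = opY f"
  | "genop Gen_Yinv f = opYi f"
  | "genop Gen_Z f = opZ f"
  | "genop Gen_Zinv f = opZi f"

definition wordop :: "daha_word \<Rightarrow> (int \<Rightarrow> complex) \<Rightarrow> int \<Rightarrow> complex"
  where "wordop w f = foldr genop (letters w) f"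

definition act :: "daha_free \<Rightarrow> (int \<Rightarrow> complex) \<Rightarrow> int \<Rightarrow> complex"
  where "act x f k = (\<Sum>w\<in>Poly_Mapping.keys x. Poly_Mapping.lookup x w * wordop w f k)"

lemma genop_linear: "genop g (\<lambda>i. u * f i + v * e i) = (\<lambda>k. u * genop g f k + v * genop g e k)"
  by (cases g) (simp_all add: op_linear[THEN ext])

lemma wordop_linear: "wordop w (\<lambda>i. u * f i + v * e i) = (\<lambda>k. u * wordop w f k + v * wordop w e k)"
proof -
  have "foldr genop gs (\<lambda>i. u * f i + v * e i) = (\<lambda>k. u * foldr genop gs f k + v * foldr genop gs e k)" for gs
    by (induction gs) (simp_all add: genop_linear)
  then show ?thesis by (simp add: wordop_def)
qed

lemma act_superset:
  "finite A \<Longrightarrow> Poly_Mapping.keys x \<subseteq> A \<Longrightarrow> act x f k = (\<Sum>w\<in>A. Poly_Mapping.lookup x w * wordop w f k)"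
  unfolding act_def by (rule sum.mono_neutral_left) (auto simp: in_keys_iff)

lemma act_linear: "act x (\<lambda>i. u * f i + v * e i) k = u * act x f k + v * act x e k"
  by (simp add: act_def wordop_linear sum_distrib_left sum.distrib[symmetric] algebra_simps)

lemma act_add: "act (x + y) f k = act x f k + act y f k"
proof -
  let ?A = "Poly_Mapping.keys x \<union> Poly_Mapping.keys y"
  have "act (x + y) f k = (\<Sum>w\<in>?A. Poly_Mapping.lookup (x + y) w * wordop w f k)"
    using Poly_Mapping.keys_add[of x y] by (intro act_superset) auto
  also have "\<dots> = act x f k + act y f k"
    by (simp add: act_superset[of ?A] lookup_add distrib_right sum.distrib)
  finally show ?thesis .
qed

lemma act_zero: "act 0 f k = 0"
  by (simp add: act_def)

lemma act_single: "act (Poly_Mapping.single w r) f k = r * wordop w f k"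
  by (subst act_superset[of "{w}"]) (auto simp: lookup_single)

lemma act_uminus: "act (- x) f k = - act x f k"
  using act_add[of "- x" x f k] by (simp add: act_zero eq_neg_iff_add_eq_0)

lemma act_diff: "act (x - y) f k = act x f k - act y f k"
  using act_add[of x "- y" f k] by (simp add: act_uminus)

lemma wordop_plus: "wordop (v + w) f = wordop v (wordop w f)"
  by (simp add: wordop_def plus_daha_word_def)

lemma act_mult: "act (x * y) f = act x (act y f)"
proof (induction x rule: free_induct)
  case (single w r)
  show ?case
  proof (induction y rule: free_induct)
    case zero
    show ?case using act_linear[of "Poly_Mapping.single w r" 0 f 0 f] by (auto simp: act_zero fun_eq_iff)
  next
    case (single v s)
    \<comment> \<open>The summand with coefficient \<open>0\<close> gives the two-term shape
      required by \<open>wordop_linear\<close>.\<close>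
    have "act (Poly_Mapping.single v s) f = (\<lambda>i. s * wordop v f i + 0 * wordop v f i)"
      by (simp add: act_single fun_eq_iff)
    then have "act (Poly_Mapping.single w r) (act (Poly_Mapping.single v s) f) k
        = r * (s * wordop w (wordop v f) k)" for k
      by (simp only: act_single wordop_linear) simp
    then show ?case
      unfolding fun_eq_iff mult_single act_single[of "w + v"] wordop_plus by (simp only: mult.assoc simp_thms)
  next
    case (add x y)
    then show ?case
      using act_linear[of "Poly_Mapping.single w r" 1 "act x f" 1 "act y f"]
      by (auto simp: fun_eq_iff distrib_left act_add[abs_def])
  qed
qed (auto simp: fun_eq_iff act_zero act_add distrib_right)

lemma act_scalar: "act (scalar r) f k = r * f k"
  by (simp add: scalar_def act_single wordop_def zero_daha_word_def)

lemma act_one: "act 1 f = f"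
  using act_scalar[of 1 f] by auto

lemma act_scale: "act (scalar r * x) f k = r * act x f k"
  by (simp add: act_mult act_scalar)

lemma act_gen: "act (gen g) f = genop g f"
  by (auto simp: gen_def act_single wordop_def fun_eq_iff)

lemma opZ_opZi: "opZ (opZi f) k = f k" "opZi (opZ f) k = f k"
  using z_nz by (simp_all add: opZ_def opZi_def)

text \<open>Every relation is one of the operator identities above. \<open>opT_opT\<close> is fixed
  to \<open>f\<close> and \<open>k\<close>, because in general form it would also rewrite
  \<open>opT (opY f)\<close>, which abbreviates \<open>opT (opT (opU f))\<close>.\<close>

lemma act_relation:
  assumes "(l, r) \<in> daha_relations q a b c d"
  shows "act l f k = act r f k"
  using assms unfolding daha_relations_def Let_def insert_iff prod.inject
  by (elim disjE conjE emptyE; hypsubst; simp only: act_mult act_gen genop.simps act_add act_diff act_uminus act_scale act_scalar act_one)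
    (simp_all only: opT_opT[of f k] opT_opZ opT_opZi rel_TY rel_TYi rel_YZ rel_YZi rel_YiZ rel_YiZi
      opZ_opZi opT_opTi opTi_opT opU_opUi opUi_opU, simp_all add: algebra_simps)

text \<open>The kernel of the action is a two-sided ideal containing the relations.\<close>

lemma act_ideal:
  assumes "x \<in> daha_ideal q a b c d"
  shows "act x f k = 0"
proof -
  interpret R: ring free_ring by (rule ring_free_ring)
  let ?K = "{x. \<forall>f k. act x f k = 0}"
  have inv: "\<ominus>\<^bsub>free_ring\<^esub> x = - x" for x :: daha_free
    by (rule R.minus_equality) (simp_all add: ring_of_type_algebra_def)
  have plus: "x \<oplus>\<^bsub>free_ring\<^esub> y = x + y" and car: "carrier free_ring = UNIV" for x y :: daha_free
    by (simp_all add: ring_of_type_algebra_def)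
  have "subgroup ?K (add_monoid free_ring)"
    by (rule R.add.subgroupI)
      (auto simp: inv plus car act_add act_uminus act_zero intro!: exI[of _ 0])
  then have "ideal ?K free_ring"
  proof (rule idealI[OF ring_free_ring])
    fix x y :: daha_free assume x: "x \<in> ?K"
    then have "act x f = (\<lambda>k. 0)" for f by auto
    then show "y \<otimes>\<^bsub>free_ring\<^esub> x \<in> ?K" "x \<otimes>\<^bsub>free_ring\<^esub> y \<in> ?K"
      using act_linear[of y 0 "\<lambda>k. 0" 0 "\<lambda>k. 0"]
      by (auto simp: ring_of_type_algebra_def act_mult)
  qed
  moreover have "{l - r | l r. (l, r) \<in> daha_relations q a b c d} \<subseteq> ?K"
    by (auto simp: act_diff act_relation)
  ultimately have "daha_ideal q a b c d \<subseteq> ?K"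
    unfolding daha_ideal_def by (rule R.genideal_minimal)
  then show ?thesis using assms by auto
qed

section \<open>Leading terms in the dihedral group\<close>

text \<open>The action of the infinite dihedral group on the orbit: \<open>pos 1\<close> is s and
  \<open>pos (- 1)\<close> is s_0, even numbers are translations and odd ones reflections.\<close>

definition pos :: "int \<Rightarrow> int \<Rightarrow> int"
  where "pos j k = (if even j then k + j else - j - k)"

text \<open>The operator has a nonzero coefficient at the group element numbered \<open>j\<close> and otherwise involves
  only elements of smaller length.\<close>

definition leads :: "((int \<Rightarrow> complex) \<Rightarrow> int \<Rightarrow> complex) \<Rightarrow> int \<Rightarrow> bool"
  where "leads A j \<longleftrightarrow> (\<forall>k. \<exists>l. l \<noteq> 0 \<and>
    (\<forall>f. (\<forall>i. \<bar>i\<bar> < \<bar>j\<bar> \<longrightarrow> f (pos i k) = 0) \<longrightarrow> A f k = l * f (pos j k)))"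

lemma leads_id: "leads (\<lambda>f. f) 0"
  by (auto simp: leads_def pos_def intro!: exI[of _ 1])

text \<open>The sign condition says that the reflection numbered \<open>e\<close> lengthens the
  element: \<open>\<bar>e - j\<bar> = \<bar>j\<bar> + 1\<close>. A function vanishing at all shorter
  elements then also kills the term \<open>u k * A f k\<close>, and the leading coefficient is
  multiplied by \<open>v k\<close>.\<close>

lemma leads_reflect:
  assumes A: "leads A j" and e: "e = 1 \<and> j \<le> 0 \<or> e = - 1 \<and> 0 \<le> j"
    and B: "\<And>f k. B f k = u k * A f k + v k * A f (- e - k)" and v: "\<And>k. v k \<noteq> 0"
  shows "leads B (e - j)"
  unfolding leads_def
proof
  fix k
  have pos: "pos i (- e - k) = pos (e - i) k" for i
    using e by (auto simp: pos_def)
  obtain l0 where l0: "\<And>f. (\<forall>i. \<bar>i\<bar> < \<bar>j\<bar> \<longrightarrow> f (pos i k) = 0) \<Longrightarrow> A f k = l0 * f (pos j k)"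
    using A unfolding leads_def by meson
  obtain l where l: "l \<noteq> 0"
    "\<And>f. (\<forall>i. \<bar>i\<bar> < \<bar>j\<bar> \<longrightarrow> f (pos i (- e - k)) = 0) \<Longrightarrow> A f (- e - k) = l * f (pos j (- e - k))"
    using A unfolding leads_def by meson
  have "B f k = v k * l * f (pos (e - j) k)" if f: "\<forall>i. \<bar>i\<bar> < \<bar>e - j\<bar> \<longrightarrow> f (pos i k) = 0" for f
  proof -
    have "A f k = l0 * f (pos j k)" using e by (intro l0) (auto intro!: f[rule_format])
    moreover have "f (pos j k) = 0" using e by (intro f[rule_format]) auto
    moreover have "A f (- e - k) = l * f (pos (e - j) k)"
      unfolding pos[symmetric] using e by (intro l(2)) (auto simp: pos intro!: f[rule_format])
    ultimately show ?thesis by (simp add: B)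
  qed
  then show "\<exists>l. l \<noteq> 0 \<and> (\<forall>f. (\<forall>i. \<bar>i\<bar> < \<bar>e - j\<bar> \<longrightarrow> f (pos i k) = 0) \<longrightarrow> B f k = l * f (pos (e - j) k))"
    using l(1) v by (intro exI[of _ "v k * l"]) auto
qed

text \<open>Here and in \<open>delta_nz\<close> the values 1/a, 1/b, c, d excluded from the orbit
  enter; the nonvanishing keeps leading coefficients alive and later lets a commuting multiplier be
  compared at reflected points.\<close>

lemma beta_nz: "beta k \<noteq> 0"
  using z_sq1[of k] z_a[of k] z_b[of k] by (simp add: beta_def)

lemma delta_nz: "delta k \<noteq> 0"
  using z_sqq[of k] z_c[of k] z_d[of k] by (auto simp: delta_def)

lemma leads_ops:
  assumes "leads A j"
  shows "j \<le> 0 \<Longrightarrow> leads (\<lambda>f. opT (A f)) (1 - j)" "j \<le> 0 \<Longrightarrow> leads (\<lambda>f. opTi (A f)) (1 - j)"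
    "0 \<le> j \<Longrightarrow> leads (\<lambda>f. opU (A f)) (- 1 - j)" "0 \<le> j \<Longrightarrow> leads (\<lambda>f. opUi (A f)) (- 1 - j)"
proof -
  show "leads (\<lambda>f. opT (A f)) (1 - j)" if "j \<le> 0"
    using that by (intro leads_reflect[OF assms, where u = alpha and v = beta])
      (auto simp: opT_def beta_nz)
  show "leads (\<lambda>f. opTi (A f)) (1 - j)" if "j \<le> 0"
    using that nz(1-5) by (intro leads_reflect[OF assms, where
        u = "\<lambda>k. - (alpha k + a * b + 1) / (a * b)" and v = "\<lambda>k. - beta k / (a * b)"])
      (auto simp: opTi_def opT_def beta_nz field_simps)
  show "leads (\<lambda>f. opU (A f)) (- 1 - j)" if "0 \<le> j"
    using that by (intro leads_reflect[OF assms, where u = gamma and v = delta])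
      (auto simp: opU_def delta_nz)
  show "leads (\<lambda>f. opUi (A f)) (- 1 - j)" if "0 \<le> j"
    using that nz(1-5) by (intro leads_reflect[OF assms, where
        u = "\<lambda>k. - (gamma k + h) * q / (c * d)" and v = "\<lambda>k. - delta k * q / (c * d)"])
      (auto simp: opUi_def opU_def delta_nz field_simps)
qed

text \<open>T_0 takes \<open>j\<close> to \<open>- 1 - j\<close>, which is negative, and T_1 takes
  this to \<open>j + 2\<close>; both steps lengthen.\<close>

lemma leads_Y: "leads A j \<Longrightarrow> 0 \<le> j \<Longrightarrow> leads (\<lambda>f. opY (A f)) (j + 2)"
  using leads_ops(1)[OF leads_ops(3)[of A j]] by (simp add: algebra_simps)

lemma leads_Yi: "leads A j \<Longrightarrow> j \<le> 0 \<Longrightarrow> leads (\<lambda>f. opYi (A f)) (j - 2)"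
  using leads_ops(4)[OF leads_ops(2)[of A j]] by (simp add: algebra_simps)

lemma leads_bas: "leads (act (bas j)) j"
proof -
  have T: "leads (\<lambda>f. opT f) 1" using leads_ops(1)[OF leads_id] by simp
  have Ui: "leads (\<lambda>f. opUi f) (- 1)" using leads_ops(4)[OF leads_id] by simp
  have act_gen_mult: "act (gen g * x) = (\<lambda>f. genop g (act x f))" for g x
    by (auto simp: act_mult act_gen fun_eq_iff)
  have Y: "leads (act (gY ^ n)) (2 * int n)" for n
  proof (induction n)
    case 0 show ?case using leads_id by (simp add: act_one[abs_def])
  next
    case (Suc n) show ?case using leads_Y[OF Suc.IH] by (simp add: act_gen_mult algebra_simps)
  qed
  have YT: "leads (act (gY ^ n * gT)) (2 * int n + 1)" for n
  proof (induction n)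
    case 0 show ?case using T by (simp add: act_gen[abs_def])
  next
    case (Suc n) show ?case using leads_Y[OF Suc.IH] by (simp add: mult.assoc act_gen_mult algebra_simps)
  qed
  have V: "leads (act (gY' ^ n)) (- 2 * int n)" for n
  proof (induction n)
    case 0 show ?case using leads_id by (simp add: act_one[abs_def])
  next
    case (Suc n)
    have "- 2 * int n - 2 = - 2 * int (Suc n)" by simp
    then show ?case using leads_Yi[OF Suc.IH] by (simp only: act_gen_mult power_Suc genop.simps)
  qed
  \<comment> \<open>The induction starts at exponent one, because T_1 leads at \<open>1\<close>,
    outside the range of \<open>leads_Yi\<close>, whereas Y^-1 T_1 = T_0^-1 leads at
    \<open>- 1\<close>.\<close>
  have VT: "leads (act (gY' ^ Suc n * gT)) (- 2 * int n - 1)" for n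
  proof (induction n)
    case 0 show ?case using Ui by (simp add: act_gen_mult act_gen[abs_def] opTi_opT)
  next
    case (Suc n)
    have "- 2 * int n - 1 - 2 = - 2 * int (Suc n) - 1" by simp
    then show ?case using leads_Yi[OF Suc.IH] by (simp only: act_gen_mult power_Suc mult.assoc genop.simps)
  qed
  define n where "n = j div 2"
  show ?thesis
  proof (cases "even j")
    case True
    then have j: "j = 2 * n" by (simp add: n_def)
    show ?thesis using Y[of "nat n"] V[of "nat (- n)"] by (auto simp: j bas_def Ypow_def)
  next
    case False
    then have j: "j = 2 * n + 1" unfolding n_def by presburger
    show ?thesis
    proof (cases "n \<ge> 0")
      case True
      then show ?thesis using YT[of "nat n"] by (auto simp: j bas_def Ypow_def)
    next
      case False
      then have "nat (- n) = Suc (nat (- n - 1))" by simp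
      then show ?thesis using False VT[of "nat (- n - 1)"] by (auto simp: j bas_def Ypow_def algebra_simps)
    qed
  qed
qed

lemma act_Zpow: "act (Zpow m) f k = z k powi m * f k"
proof -
  have Z: "act (gZ ^ n) f k = z k ^ n * f k" for n
    by (induction n) (simp_all add: act_one act_mult act_gen opZ_def)
  have Zi: "act (gZ' ^ n) f k = f k / z k ^ n" for n
    by (induction n) (simp_all add: act_one act_mult act_gen opZi_def)
  show ?thesis by (simp add: Zpow_def Z Zi power_int_def field_simps)
qed

end

section \<open>Linear independence of the monomials\<close>

text \<open>Multiplication by \<open>w ^ N\<close> clears negative exponents and leaves a polynomial
  with infinitely many roots.\<close>

lemma laurent_zero:
  fixes s :: "int \<Rightarrow> 'a::field"
  assumes M: "finite M" and S: "infinite S" and nz: "0 \<notin> S"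
    and zero: "\<And>w. w \<in> S \<Longrightarrow> (\<Sum>m\<in>M. s m * w powi m) = 0" and m: "m \<in> M"
  shows "s m = 0"
proof -
  obtain N :: nat where N: "\<And>m. m \<in> M \<Longrightarrow> 0 \<le> m + int N"
  proof
    show "0 \<le> m + int (nat (\<Sum>m\<in>M. \<bar>m\<bar>))" if "m \<in> M" for m
      using member_le_sum[OF that, of abs] M sum_nonneg[of M abs] by auto
  qed
  define p where "p = (\<Sum>m\<in>M. monom (s m) (nat (m + int N)))"
  have "poly p w = 0" if "w \<in> S" for w
  proof -
    have "w \<noteq> 0" using that nz by auto
    then have "w ^ nat (m + int N) = w ^ N * w powi m" if "m \<in> M" for m
      using N[OF that] by (simp add: power_int_nonneg_exp[symmetric] power_int_add)
    then have "poly p w = w ^ N * (\<Sum>m\<in>M. s m * w powi m)"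
      by (simp add: p_def poly_sum poly_monom sum_distrib_left mult_ac)
    then show ?thesis using zero[OF that] by simp
  qed
  then have "S \<subseteq> {w. poly p w = 0}" by auto
  then have "p = 0" using S poly_roots_finite finite_subset by blast
  then have "0 = coeff p (nat (m + int N))" by simp
  also have "\<dots> = (\<Sum>m'\<in>M. if m' = m then s m' else 0)"
    unfolding p_def coeff_sum using N[OF m] N by (intro sum.cong) (auto simp: eq_nat_nat_iff)
  also have "\<dots> = s m" using M m by simp
  finally show ?thesis by simp
qed

context generic_orbit
begin

text \<open>Let \<open>j\<close> have maximal length among the indices with nonzero coefficient. A
  delta function at \<open>pos j k\<close> isolates the terms of index \<open>j\<close>, which form
  a Laurent polynomial in \<open>z k\<close> vanishing for all large \<open>k\<close>.\<close>

lemma monomials_independent: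
  assumes F: "finite F"
    and zero: "\<And>f k. (\<Sum>p\<in>F. s p * (z k powi fst p * act (bas (snd p)) f k)) = 0"
    and p: "p \<in> F"
  shows "s p = 0"
proof (rule ccontr)
  assume "s p \<noteq> 0"
  define F' where "F' = {p \<in> F. s p \<noteq> 0}"
  have F': "finite F'" "p \<in> F'" using F p \<open>s p \<noteq> 0\<close> by (auto simp: F'_def)
  define L where "L = Max ((\<lambda>p. \<bar>snd p\<bar>) ` F')"
  have "L \<in> (\<lambda>p. \<bar>snd p\<bar>) ` F'" unfolding L_def using F' by (intro Max_in) auto
  then obtain p0 where p0: "p0 \<in> F'" "\<bar>snd p0\<bar> = L" by auto
  have L: "\<bar>snd p\<bar> \<le> L" if "p \<in> F'" for p
    unfolding L_def using that F' by (intro Max_ge) auto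
  define j where "j = snd p0"
  define M where "M = {m. (m, j) \<in> F'}"
  have M: "finite M" unfolding M_def using F'(1) by (rule finite_subset[rotated, OF finite_imageI[of _ fst]]) force
  have sum0: "(\<Sum>m\<in>M. s (m, j) * z k powi m) = 0" if k: "k > L" for k
  proof -
    define f where "f = (\<lambda>i. if i = pos j k then 1 else 0 :: complex)"
    \<comment> \<open>For \<open>k > L\<close> the even \<open>i\<close> land at positive points and
      the odd ones at negative points, so no two coincide.\<close>
    have pos: "pos i k = pos j k \<longleftrightarrow> i = j" if "\<bar>i\<bar> \<le> L" for i
      using that k p0(2) by (auto simp: pos_def j_def)
    obtain l where l: "l \<noteq> 0" "act (bas j) f k = l"
    proof -
      obtain l where l: "l \<noteq> 0"
        "\<forall>f. (\<forall>i. \<bar>i\<bar> < \<bar>j\<bar> \<longrightarrow> f (pos i k) = 0) \<longrightarrow> act (bas j) f k = l * f (pos j k)"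
        using leads_bas[of j] unfolding leads_def by blast
      have "act (bas j) f k = l * f (pos j k)"
        using pos p0(2) by (intro l(2)[rule_format]) (auto simp: f_def j_def)
      then show thesis using that l(1) by (simp add: f_def)
    qed
    \<comment> \<open>This includes \<open>i = - j\<close>, of the same length: its leading term
      sits at a point where \<open>f\<close> vanishes.\<close>
    have other: "act (bas i) f k = 0" if i: "\<bar>i\<bar> \<le> L" "i \<noteq> j" for i
    proof -
      obtain l where
        l: "\<forall>f. (\<forall>i'. \<bar>i'\<bar> < \<bar>i\<bar> \<longrightarrow> f (pos i' k) = 0) \<longrightarrow> act (bas i) f k = l * f (pos i k)"
        using leads_bas[of i] unfolding leads_def by blast
      have "act (bas i) f k = l * f (pos i k)"
        using pos p0(2) i by (intro l[rule_format]) (auto simp: f_def j_def)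
      then show ?thesis using pos[of i] i by (simp add: f_def)
    qed
    have "0 = (\<Sum>p\<in>F. s p * (z k powi fst p * act (bas (snd p)) f k))" using zero by simp
    also have "\<dots> = (\<Sum>p\<in>(\<lambda>m. (m, j)) ` M. s p * (z k powi fst p * act (bas (snd p)) f k))"
    proof (intro sum.mono_neutral_right ballI)
      fix p assume "p \<in> F - (\<lambda>m. (m, j)) ` M"
      then have "s p = 0 \<or> p \<in> F' \<and> snd p \<noteq> j" by (cases p) (auto simp: M_def F'_def)
      then show "s p * (z k powi fst p * act (bas (snd p)) f k) = 0" using other[OF L[of p]] by auto
    qed (use F in \<open>auto simp: M_def F'_def\<close>)
    also have "\<dots> = (\<Sum>m\<in>M. s (m, j) * z k powi m) * l"
      by (subst sum.reindex) (auto simp: inj_on_def l sum_distrib_right mult.assoc)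
    finally show ?thesis using l by simp
  qed
  have "infinite (z ` {L<..})"
    using z_inj by (simp add: finite_image_iff inj_on_subset infinite_Ioi)
  moreover have "0 \<notin> z ` {L<..}" using z_nz by (metis imageE)
  moreover have "fst p0 \<in> M" using p0 by (simp add: M_def j_def)
  ultimately have "s (fst p0, j) = 0"
    using sum0 by (intro laurent_zero[OF M, where s = "\<lambda>m. s (m, j)" and S = "z ` {L<..}"]) auto
  then show False using p0 by (simp add: F'_def j_def)
qed

sublocale daha_congruence .

lemma normal_form:
  "\<exists>F s. finite F \<and> x - (\<Sum>p\<in>F. scalar (s p) * (Zpow (fst p) * bas (snd p))) \<in> J"
  using all_lspan[of x]
proof induction
  case (lspan_J x)
  then show ?case by (intro exI[of _ "{}"]) auto
next
  case (lspan_base x)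
  then obtain m j where "x = Zpow m * bas j" by (auto simp: Mon_def)
  then show ?case using J_ideal(1) by (intro exI[of _ "{(m, j)}"] exI[of _ "\<lambda>_. 1"]) auto
next
  case (lspan_add x y)
  let ?t = "\<lambda>s p. scalar (s p) * (Zpow (fst p) * bas (snd p))"
  from lspan_add obtain F s G t where F: "finite F" "x - (\<Sum>p\<in>F. ?t s p) \<in> J"
    and G: "finite G" "y - (\<Sum>p\<in>G. ?t t p) \<in> J" by blast
  \<comment> \<open>Extending the coefficients by zero brings both sums over the common index
    set.\<close>
  define s' t' where "s' p = (if p \<in> F then s p else 0)" and "t' p = (if p \<in> G then t p else 0)" for p
  have s: "(\<Sum>p\<in>F. ?t s p) = (\<Sum>p\<in>F \<union> G. ?t s' p)"
    using F(1) G(1) by (intro sum.mono_neutral_cong_left) (auto simp: s'_def)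
  have t: "(\<Sum>p\<in>G. ?t t p) = (\<Sum>p\<in>F \<union> G. ?t t' p)"
    using F(1) G(1) by (intro sum.mono_neutral_cong_left) (auto simp: t'_def)
  have "x + y - (\<Sum>p\<in>F \<union> G. ?t (\<lambda>p. s' p + t' p) p)
      = (x - (\<Sum>p\<in>F. ?t s p)) + (y - (\<Sum>p\<in>G. ?t t p))"
    unfolding s t by (simp add: scalar_add distrib_right sum.distrib)
  also have "\<dots> \<in> J" using F(2) G(2) by (rule J_ideal(2))
  finally show ?case using F(1) G(1)
    by (intro exI[of _ "F \<union> G"] exI[of _ "\<lambda>p. s' p + t' p"] conjI) simp_all
next
  case (lspan_scale x r)
  then obtain F s where F: "finite F" "x - (\<Sum>p\<in>F. scalar (s p) * (Zpow (fst p) * bas (snd p))) \<in> J"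
    by blast
  have "scalar r * x - (\<Sum>p\<in>F. scalar (r * s p) * (Zpow (fst p) * bas (snd p)))
      = scalar r * (x - (\<Sum>p\<in>F. scalar (s p) * (Zpow (fst p) * bas (snd p))))"
    by (simp add: right_diff_distrib sum_distrib_left scalar_mult mult.assoc)
  also have "\<dots> \<in> J" using F(2) by (rule J_ideal(3))
  finally show ?case using F(1)
    by (intro exI[of _ F] exI[of _ "\<lambda>p. r * s p"] conjI) simp_all
qed

lemma act_faithful:
  assumes "\<And>f k. act x f k = 0"
  shows "x \<in> J"
proof -
  obtain F s where F: "finite F" "x - (\<Sum>p\<in>F. scalar (s p) * (Zpow (fst p) * bas (snd p))) \<in> J"
    using normal_form by blast
  let ?y = "\<Sum>p\<in>F. scalar (s p) * (Zpow (fst p) * bas (snd p))"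
  have "act ?y f k = (\<Sum>p\<in>F. act (scalar (s p) * (Zpow (fst p) * bas (snd p))) f k)" for f k
    using F(1) by (induction F) (simp_all add: act_zero act_add)
  moreover have "act (scalar r * (Zpow m * bas j)) f k = r * (z k powi m * act (bas j) f k)" for r m j f k
    by (simp only: act_scale) (simp add: act_mult act_Zpow)
  ultimately have "(\<Sum>p\<in>F. s p * (z k powi fst p * act (bas (snd p)) f k)) = act ?y f k" for f k
    by simp
  also have "act ?y f k = 0" for f k
    using act_ideal[OF F(2), of f k] assms by (simp add: act_diff)
  finally have "s p = 0" if "p \<in> F" for p
    using monomials_independent[OF F(1)] that by blast
  then show ?thesis using F(2) by simp
qed

section \<open>Central elements act as constants\<close>

lemma central_scalar:
  assumes central: "\<And>y. x * y - y * x \<in> J"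
  shows "\<exists>r. x - scalar r \<in> J"
proof -
  define C where "C = act x"
  have comm: "C (act y f) = act y (C f)" for y f
    using act_ideal[OF central[of y]] by (auto simp: C_def act_diff act_mult fun_eq_iff)
  have lin: "C (\<lambda>i. u * f i + v * e i) k = u * C f k + v * C e k" for u v f e k
    by (simp add: C_def act_linear)
  have local: "C f k = 0" if "f k = 0" for f k
  proof -
    \<comment> \<open>\<open>g\<close> is \<open>f\<close> divided by \<open>z - z k\<close>, which
      vanishes only at \<open>k\<close> because \<open>z\<close> is injective; as
      \<open>f k = 0\<close>, any value at \<open>k\<close> would do. Commuting with Z then makes
      the two terms of \<open>C f k\<close> cancel.\<close>
    define g where "g i = (if i = k then 0 else f i / (z i - z k))" for i
    have "f i = 1 * opZ g i + (- z k) * g i" for i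
    proof (cases "i = k")
      case False
      then have "z i - z k \<noteq> 0" using injD[OF z_inj, of i k] by auto
      then show ?thesis using False by (simp add: g_def opZ_def divide_simps) (simp add: algebra_simps)
    qed (use that in \<open>simp add: g_def opZ_def\<close>)
    then have "f = (\<lambda>i. 1 * opZ g i + (- z k) * g i)" by (rule ext)
    then have "C f k = C (opZ g) k - z k * C g k" using lin[of 1 "opZ g" "- z k" g] by simp
    also have "C (opZ g) k = z k * C g k" using comm[of gZ g] by (simp add: act_gen opZ_def)
    finally show ?thesis by simp
  qed
  define p where "p = C (\<lambda>_. 1)"
  have mult: "C f k = p k * f k" for f k
  proof -
    \<comment> \<open>Subtracting the constant \<open>f k\<close> gives a function vanishing at
      \<open>k\<close>, to which locality applies.\<close>
    have "C (\<lambda>i. 1 * f i + (- f k) * 1) k = 0" by (rule local) simp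
    then show ?thesis unfolding lin p_def by simp
  qed
  have C: "C f = (\<lambda>k. p k * f k)" for f using mult by auto
  have commT: "opT (\<lambda>k. p k * f k) k = p k * opT f k" for f k
    using comm[of gT f, symmetric] by (simp add: act_gen C fun_eq_iff)
  have commY: "opY (\<lambda>k. p k * f k) k = p k * opY f k" for f k
    using comm[of gY f, symmetric] by (simp add: act_gen C fun_eq_iff)
  have commTi: "opTi (\<lambda>k. p k * f k) k = p k * opTi f k" for f k
    by (simp only: opTi_def commT) (simp add: algebra_simps add_divide_distrib)
  have commU: "opU (\<lambda>k. p k * f k) k = p k * opU f k" for f k
  proof -
    have "opU (\<lambda>k. p k * f k) = opTi (opY (\<lambda>k. p k * f k))" by (simp add: opTi_opT)
    also have "opY (\<lambda>k. p k * f k) = (\<lambda>k. p k * opY f k)" by (simp add: commY fun_eq_iff)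
    finally show ?thesis by (simp add: commTi opTi_opT)
  qed
  \<comment> \<open>On the constant function \<open>1\<close> the diagonal terms cancel, and
    division by \<open>beta k\<close> or \<open>delta k\<close> leaves the invariance of
    \<open>p\<close>.\<close>
  have s1: "p (- 1 - k) = p k" and s0: "p (1 - k) = p k" for k
    using commT[of "\<lambda>_. 1" k] commU[of "\<lambda>_. 1" k] beta_nz[of k] delta_nz[of k]
    by (simp_all add: opT_def opU_def algebra_simps)
  have step: "p (k + 2) = p k" for k
    using s0[of "- 1 - k"] s1[of k] by (simp add: algebra_simps)
  have even: "p (2 * int n) = p 0" "p (- 2 * int n) = p 0" for n
  proof (induction n)
    case (Suc n)
    show "p (2 * int (Suc n)) = p 0" "p (- 2 * int (Suc n)) = p 0"
      using step[of "2 * int n"] step[of "- 2 * int (Suc n)"] Suc by (simp_all add: algebra_simps)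
  qed auto
  have even': "p (2 * n) = p 0" for n
    using even[of "nat n"] even[of "nat (- n)"] by (cases "n \<ge> 0") auto
  have const: "p k = p 0" for k
  proof (cases "even k")
    case True then show ?thesis using even'[of "k div 2"] by simp
  next
    case False
    \<comment> \<open>The reflection s_0 carries odd indices to even ones.\<close>
    then have "1 - k = 2 * ((1 - k) div 2)" by simp
    then show ?thesis using even'[of "(1 - k) div 2"] s0[of k] by simp
  qed
  have "act (x - scalar (p 0)) f k = 0" for f k
    using mult[of f k] const[of k] by (simp add: act_diff act_scalar C_def)
  then show ?thesis using act_faithful by blast
qed

end

section \<open>Existence of a generic point\<close>

lemma power_int_eq_iff:
  fixes q :: complex
  assumes q0: "q \<noteq> 0" and q: "\<And>m::nat. m \<ge> 1 \<Longrightarrow> q ^ m \<noteq> 1"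
  shows "q powi i = q powi j \<longleftrightarrow> i = j"
proof -
  have *: "\<not> i < j" if "q powi i = q powi j" for i j
  proof
    assume "i < j"
    have "q powi (j - i) = 1" using that q0 by (simp add: power_int_diff)
    then show False using q[of "nat (j - i)"] \<open>i < j\<close> by (simp add: power_int_nonneg_exp)
  qed
  show ?thesis using *[of i j] *[of j i] by (cases i j rule: linorder_cases) auto
qed

text \<open>Orbit points have the form q^j x or q^j / x, so each forbidden coincidence excludes only
  countably many \<open>x\<close>, collected in \<open>B\<close>.\<close>

lemma generic_orbit_exists:
  fixes q a b c d :: complex
  assumes q0: "q \<noteq> 0" and q: "\<And>m::nat. m \<ge> 1 \<Longrightarrow> q ^ m \<noteq> 1"
    and nz: "a \<noteq> 0" "b \<noteq> 0" "c \<noteq> 0" "d \<noteq> 0"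
  shows "\<exists>z. generic_orbit q a b c d z"
proof -
  define S where "S = {1 / a, 1 / b, c, d}"
  define B where "B = {0} \<union> (range (\<lambda>m. csqrt (q powi m)) \<union> range (\<lambda>m. - csqrt (q powi m)))
    \<union> (\<Union>s\<in>S. range (\<lambda>m. s * q powi m) \<union> range (\<lambda>m. q powi m / s))"
  have "countable B" unfolding B_def S_def by auto
  then obtain x where x: "x \<notin> B" using uncountable_UNIV_complex by (metis UNIV_I countable_subset subsetI)
  have x0: "x \<noteq> 0" using x by (auto simp: B_def)
  have sq: "x ^ 2 \<noteq> q powi m" for m
  proof
    assume "x ^ 2 = q powi m"
    then have "x ^ 2 = csqrt (q powi m) ^ 2" by simp
    then have "x = csqrt (q powi m) \<or> x = - csqrt (q powi m)" by (rule power2_eq_iff[THEN iffD1])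
    then show False using x by (auto simp: B_def)
  qed
  \<comment> \<open>The numbering has \<open>z 0 = x\<close>, \<open>z (- 1) = 1 / x\<close> and
    \<open>z 1 = q / x\<close>: even indices carry x and odd ones 1/x.\<close>
  define z where "z k = (if even k then q powi (k div 2) * x else q powi ((k + 1) div 2) / x)" for k
  have cases: "\<exists>j. z k = q powi j * x \<or> z k = q powi j / x" for k by (auto simp: z_def)
  have zS: "z k \<noteq> s" if s: "s \<in> S" for k s
  proof
    have s0: "s \<noteq> 0" using s nz by (auto simp: S_def)
    assume "z k = s"
    then obtain j where "q powi j * x = s \<or> q powi j / x = s" using cases[of k] by metis
    then have "x = s * q powi (- j) \<or> x = q powi j / s"
      using x0 q0 s0 by (auto simp: power_int_minus field_simps)
    then show False using x s by (auto simp: B_def)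
  qed
  have zsq: "z k ^ 2 \<noteq> q powi m" for k m
  proof
    assume *: "z k ^ 2 = q powi m"
    obtain j where "z k = q powi j * x \<or> z k = q powi j / x" using cases by metis
    then have "x ^ 2 = q powi (m - 2 * j) \<or> x ^ 2 = q powi (2 * j - m)"
    proof
      assume "z k = q powi j * x"
      then have "q powi (2 * j) * x ^ 2 = q powi m"
        using * by (simp add: power_mult_distrib power_int_power'[symmetric] power_int_mult mult.commute[of 2])
      then show ?thesis using q0 by (simp add: power_int_diff field_simps)
    next
      assume "z k = q powi j / x"
      then have "q powi (2 * j) / x ^ 2 = q powi m"
        using * by (simp add: power_divide power_int_power'[symmetric] power_int_mult mult.commute[of 2])
      then show ?thesis using q0 x0 by (simp add: power_int_diff field_simps)
    qed
    then show False using sq by blast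
  qed
  have inj: "inj z"
  proof (rule injI)
    \<comment> \<open>A collision between indices of different parity would make
      \<open>x ^ 2\<close> a power of \<open>q\<close>; for equal parity the powers of
      \<open>q\<close> are distinct.\<close>
    have mixed: "q powi i * x \<noteq> q powi j / x" for i j
    proof
      assume "q powi i * x = q powi j / x"
      then have "x ^ 2 = q powi (j - i)" using x0 q0 by (simp add: power_int_diff field_simps power2_eq_square)
      then show False using sq by blast
    qed
    fix k l assume "z k = z l"
    then show "k = l"
      using mixed[of "k div 2" "(l + 1) div 2"] mixed[of "l div 2" "(k + 1) div 2"] x0
      by (auto simp: z_def power_int_eq_iff[OF q0 q] split: if_splits elim!: evenE oddE)
  qed
  have "generic_orbit q a b c d z"
  proof
    fix k
    show "z k \<noteq> 0" using x0 q0 by (simp add: z_def)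
    show "z (- 1 - k) = 1 / z k"
    proof (cases "even k")
      case True
      then obtain j where "k = 2 * j" by (elim evenE)
      moreover have "z (- 1 - 2 * j) = q powi (- j) / x"
      proof -
        have "(- 1 - 2 * j + 1) div 2 = - j" by presburger
        then show ?thesis unfolding z_def by simp
      qed
      ultimately show ?thesis by (simp add: z_def power_int_minus field_simps)
    next
      case False
      then obtain j where k: "k = 2 * j + 1" by (elim oddE)
      have "(- 1 - k) div 2 = - j - 1" "(k + 1) div 2 = j + 1" using k by simp_all
      then have "z (- 1 - k) = q powi (- j - 1) * x" "z k = q powi (j + 1) / x"
        by (simp_all only: z_def k) simp_all
      moreover have "q powi (- j - 1) = 1 / q powi (j + 1)"
      proof -
        have "- j - 1 = - (j + 1)" by simp
        then show ?thesis by (simp only: power_int_minus_divide)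
      qed
      ultimately show ?thesis by simp
    qed
    show "z (1 - k) = q / z k"
    proof (cases "even k")
      case True
      then obtain j where k: "k = 2 * j" by (elim evenE)
      have "z (1 - k) = q powi (1 - j) / x" "z k = q powi j * x"
        unfolding z_def k by simp_all
      then show ?thesis using q0 by (simp add: power_int_diff)
    next
      case False
      then obtain j where k: "k = 2 * j + 1" by (elim oddE)
      have "(1 - k) div 2 = - j" "(k + 1) div 2 = j + 1" using k by simp_all
      then have "z (1 - k) = q powi (- j) * x" "z k = q powi (j + 1) / x"
        by (simp_all only: z_def k) simp_all
      then show ?thesis using q0 by (simp add: power_int_minus power_int_add field_simps)
    qed
    show "z k ^ 2 \<noteq> 1" "z k ^ 2 \<noteq> q" using zsq[of k 0] zsq[of k 1] by simp_all
    show "a * z k \<noteq> 1" "b * z k \<noteq> 1" "z k \<noteq> c" "z k \<noteq> d"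
      using zS[of "1 / a" k] zS[of "1 / b" k] zS[of c k] zS[of d k] nz by (auto simp: S_def field_simps)
  qed (use assms inj in auto)
  then show ?thesis by blast
qed

section \<open>Passage to the quotient algebra\<close>

lemma daha_class_eq_iff: "daha_class q a b c d x = daha_class q a b c d y \<longleftrightarrow> x - y \<in> daha_ideal q a b c d"
proof -
  interpret R: ring free_ring by (rule ring_free_ring)
  interpret I: ideal "daha_ideal q a b c d" free_ring by (rule ideal_daha_ideal)
  have mem: "x \<in> daha_class q a b c d y \<longleftrightarrow> x - y \<in> daha_ideal q a b c d" for x y
    unfolding daha_class_def a_r_coset_def'
    by (auto simp: ring_of_type_algebra_def intro!: bexI[of _ "x - y"])
  show ?thesis
  proof
    assume "daha_class q a b c d x = daha_class q a b c d y"
    moreover have "x \<in> daha_class q a b c d x"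
      unfolding mem using daha_congruence.J_ideal(1) by simp
    ultimately show "x - y \<in> daha_ideal q a b c d" by (simp add: mem)
  next
    assume "x - y \<in> daha_ideal q a b c d"
    then have "x \<in> daha_ideal q a b c d +>\<^bsub>free_ring\<^esub> y" unfolding mem[symmetric] daha_class_def .
    then show "daha_class q a b c d x = daha_class q a b c d y"
      unfolding daha_class_def
      by (rule R.a_repr_independence[OF _ _ I.a_subgroup, symmetric])
        (simp_all add: ring_of_type_algebra_def)
  qed
qed

lemma daha_class_mult:
  "daha_class q a b c d (x * y) = daha_class q a b c d x \<otimes>\<^bsub>daha q a b c d\<^esub> daha_class q a b c d y"
  using ring_hom_mult[OF daha_class_hom, of x y] by (simp add: ring_of_type_algebra_def)

theorem theorem5p3:
  fixes q a b c d :: complex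
  assumes "q \<noteq> 0" and "\<And>m::nat. m \<ge> 1 \<Longrightarrow> q ^ m \<noteq> 1"
    and "a \<noteq> 0" and "b \<noteq> 0" and "c \<noteq> 0" and "d \<noteq> 0"
    and "\<And>m::nat. a * b * c * d \<noteq> inverse (q ^ m)"
    and "a * b \<noteq> 1"
  shows "ring_center (daha q a b c d) = {daha_class q a b c d (scalar k) | k. k \<in> UNIV}"
proof -
  obtain z where "generic_orbit q a b c d z"
    using generic_orbit_exists[OF assms(1-6)] by blast
  then interpret generic_orbit q a b c d z .
  show ?thesis
  proof (intro equalityI subsetI)
    fix K assume K: "K \<in> ring_center (daha q a b c d)"
    then obtain x where x: "K = daha_class q a b c d x"
      by (auto simp: ring_center_def carrier_daha)
    \<comment> \<open>Centrality of the coset means that all commutators of its representative lie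
      in the ideal.\<close>
    have "x * y - y * x \<in> J" for y
      using K unfolding ring_center_def carrier_daha x
      by (auto simp: daha_class_mult[symmetric] daha_class_eq_iff)
    then obtain r where "x - scalar r \<in> J" using central_scalar by blast
    then show "K \<in> {daha_class q a b c d (scalar k) | k. k \<in> UNIV}"
      unfolding x by (auto simp: daha_class_eq_iff)
  next
    fix K assume "K \<in> {daha_class q a b c d (scalar k) | k. k \<in> UNIV}"
    then show "K \<in> ring_center (daha q a b c d)"
      by (auto simp: ring_center_def carrier_daha daha_class_mult[symmetric] scalar_commute)
  qed
qed

end
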